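(* The space $ces_\infty$ contains a complemented subspace isomorphic to $L_1[0,1]$.
   Context: $ces_\infty$ is the space of real sequences $a=(a_n)_{n\ge1}$ with $\|a\|=\sup_{n\ge1}\frac1n\sum_{k=1}^n|a_k|<\infty$. *)

theory Defs
  imports "HOL-Analysis.Analysis"
begin

text \<open>Real sequences are functions nat => real; index k corresponds to a_(k+1).\<close>

definition ces_avg :: "(nat \<Rightarrow> real) \<Rightarrow> nat \<Rightarrow> real" where
  "ces_avg a n = (\<Sum>k\<le>n. \<bar>a k\<bar>) / real (Suc n)"

definition ces_inf :: "(nat \<Rightarrow> real) set" where
  "ces_inf = {a. bdd_above (range (ces_avg a))}"

definition ces_norm :: "(nat \<Rightarrow> real) \<Rightarrow> real" where
  "ces_norm a = (SUP n. ces_avg a n)"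

text \<open>L_1[0,1]: Lebesgue integrable real functions on [0,1], with the L1 seminorm
  (the space L_1[0,1] is the quotient modulo a.e. equality).\<close>

definition L1_01 :: "(real \<Rightarrow> real) set" where
  "L1_01 = {f. set_integrable lebesgue {0..1} f}"

definition L1_norm :: "(real \<Rightarrow> real) \<Rightarrow> real" where
  "L1_norm f = (LINT x:{0..1}|lebesgue. \<bar>f x\<bar>)"

end

theory Submission
  imports Defs "HOL-Library.Discrete_Functions"
begin

text \<open>Cut a sequence into the blocks \<open>[2\<^sup>k, 2\<^sup>k\<^sup>+\<^sup>1)\<close>; up
  to a factor 2 the norm is the supremum of the averages of the absolute values over the blocks. The
  embedding sends \<open>f\<close> to the sequence whose \<open>k\<close>-th block lists the
  averages of \<open>f\<close> over the dyadic intervals of length \<open>2\<^sup>-\<^sup>k\<close>.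

  Conversely, a block is a step function on \<open>[0,1]\<close>, hence a measure of bounded mass.
  The limit of the distribution functions of these measures along an ultrafilter depends linearly on
  the sequence, and its dyadic difference quotients form an \<open>L\<^sub>1\<close>-bounded
  martingale. Such a martingale \<open>X\<close> converges in measure: for \<open>\<phi> x = sqrt (1
  + x\<^sup>2)\<close> the expectations of \<open>\<phi> (X\<^sub>k)\<close> increase and are
  bounded, and their increments dominate the squared \<open>L\<^sub>2\<close>-distances of the
  \<open>\<phi>' (X\<^sub>k)\<close>. The limit is the density of the absolutely continuous part; it
  is integrable by Fatou's lemma, depends linearly on the sequence, and equals \<open>f\<close> when
  the sequence comes from \<open>f\<close>. Composing with the embedding gives the
  projection.\<close>

section \<open>Limits along ultrafilters\<close>

text \<open>Zorn's lemma on the proper filters below \<open>F\<close>, an ultrafilter being encoded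
  as a minimal proper filter. The infimum of a nonempty chain is a bound, and it is proper because
  whatever holds eventually for the infimum already does so for one member.\<close>

lemma ultrafilter_below:
  fixes F :: "'a filter"
  assumes "F \<noteq> bot"
  obtains U where "U \<le> F" "U \<noteq> bot" "\<And>G. G \<le> U \<Longrightarrow> G \<noteq> bot \<Longrightarrow> G = U"
proof -
  let ?A = "{G. G \<le> F \<and> G \<noteq> bot}"
  let ?P = "\<lambda>G H :: 'a filter. H \<le> G"
  have "\<exists>m\<in>?A. \<forall>a\<in>?A. ?P m a \<longrightarrow> a = m"
  proof (rule predicate_Zorn)
    show "partial_order_on ?A (relation_of ?P ?A)"
      by (auto simp: partial_order_on_def preorder_on_def refl_on_def trans_def antisym_def
          relation_of_def)
  next
    fix C assume "C \<in> Chains (relation_of ?P ?A)"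
    then have C: "C \<subseteq> ?A" and tot: "\<And>G H. G \<in> C \<Longrightarrow> H \<in> C \<Longrightarrow> G \<le> H \<or> H \<le> G"
      by (auto simp: Chains_def relation_of_def)
    show "\<exists>u\<in>?A. \<forall>a\<in>C. ?P a u"
    proof (cases "C = {}")
      case True
      then show ?thesis using assms by auto
    next
      case False
      have "\<not> eventually (\<lambda>x. False) (Inf C)"
      proof (subst eventually_Inf_base[OF False])
        show "\<exists>x\<in>C. x \<le> inf G H" if "G \<in> C" "H \<in> C" for G H
          using tot[OF that] that by auto
        show "\<not> (\<exists>b\<in>C. eventually (\<lambda>x. False) b)"
          using C by (auto simp: trivial_limit_def)
      qed
      then have "Inf C \<noteq> bot" by (simp add: trivial_limit_def)
      moreover have "Inf C \<le> F"
        using False C by (auto intro: Inf_lower2)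
      ultimately show ?thesis
        by (auto intro!: bexI[of _ "Inf C"] Inf_lower)
    qed
  qed
  then show ?thesis using that by (auto intro: order_trans)
qed

text \<open>Compactness of \<open>{-B..B}\<close> gives the image filter a cluster point
  \<open>l\<close>. The neighbourhoods of \<open>l\<close>, pulled back along \<open>u\<close>, meet
  \<open>U\<close> in a proper filter, which by minimality is \<open>U\<close> itself; so the
  cluster point is a limit.\<close>

lemma ultrafilter_bounded_tendsto:
  fixes u :: "'a \<Rightarrow> real"
  assumes "U \<noteq> bot" and max: "\<And>G. G \<le> U \<Longrightarrow> G \<noteq> bot \<Longrightarrow> G = U"
    and bnd: "\<And>n. \<bar>u n\<bar> \<le> B"
  shows "\<exists>l. (u \<longlongrightarrow> l) U"
proof -
  have "filtermap u U \<noteq> bot" using assms(1) by (simp add: filtermap_bot_iff)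
  moreover have "eventually (\<lambda>y. y \<in> {-B..B}) (filtermap u U)"
    using bnd by (simp add: eventually_filtermap abs_le_iff minus_le_iff)
  ultimately obtain l where l: "inf (nhds l) (filtermap u U) \<noteq> bot"
    using compact_Icc[of "-B" B] unfolding compact_filter by blast
  have "inf (filtercomap u (nhds l)) U \<noteq> bot"
  proof
    assume "inf (filtercomap u (nhds l)) U = bot"
    then have "eventually (\<lambda>x. False) (inf (filtercomap u (nhds l)) U)" by simp
    then obtain Q R where QR: "eventually Q (filtercomap u (nhds l))" "eventually R U"
        "\<And>x. Q x \<Longrightarrow> R x \<Longrightarrow> False"
      unfolding eventually_inf by blast
    then obtain Q' where Q': "eventually Q' (nhds l)" "\<And>x. Q' (u x) \<Longrightarrow> Q x"
      by (auto simp: eventually_filtercomap)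
    have "eventually (\<lambda>y. \<not> Q' y) (filtermap u U)"
      unfolding eventually_filtermap
      by (rule eventually_mono[OF QR(2)]) (use QR(3) Q'(2) in blast)
    with Q'(1) have "eventually (\<lambda>y. False) (inf (nhds l) (filtermap u U))"
      unfolding eventually_inf by blast
    with l show False by (simp add: trivial_limit_def)
  qed
  then have "inf (filtercomap u (nhds l)) U = U" by (intro max) auto
  then have "U \<le> filtercomap u (nhds l)" by (metis inf_le1)
  then show ?thesis by (auto simp: filterlim_def filtermap_le_iff_le_filtercomap)
qed

section \<open>A strictly convex function of linear growth\<close>

text \<open>\<open>squash\<close> is the derivative of \<open>\<phi> x = sqrt (1 + x\<^sup>2)\<close>, and the right-hand side of
  \<open>squash_bregman\<close> is the Bregman distance of \<open>\<phi>\<close>.\<close>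

definition squash :: "real \<Rightarrow> real" where
  "squash x = x / sqrt (1 + x\<^sup>2)"

lemma squash_measurable [measurable]: "squash \<in> borel_measurable borel"
  unfolding squash_def by measurable

lemma abs_squash_less_1: "\<bar>squash x\<bar> < 1"
proof -
  have "\<bar>x\<bar> < sqrt (1 + x\<^sup>2)"
    by (rule real_less_rsqrt) simp
  then show ?thesis
    by (simp add: squash_def abs_divide divide_less_eq_1 add_pos_nonneg)
qed

text \<open>The left inverse is continuous on the open interval from -1 to 1, so convergence of
  squashed values can be undone whenever the limit stays off the endpoints.\<close>

lemma unsquash: "squash x / sqrt (1 - (squash x)\<^sup>2) = x"
proof -
  have nz: "1 + x\<^sup>2 \<noteq> 0" using zero_le_power2[of x] by linarith
  then have "1 - (squash x)\<^sup>2 = 1 / (1 + x\<^sup>2)"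
    by (simp add: squash_def power_divide divide_simps)
  then show ?thesis
    using nz by (simp add: squash_def real_sqrt_divide)
qed

lemma squash_bregman:
  "(squash y - squash x)\<^sup>2 / 2 \<le> sqrt (1 + y\<^sup>2) - sqrt (1 + x\<^sup>2) - squash x * (y - x)"
proof -
  define p q where "p = sqrt (1 + x\<^sup>2)" and "q = sqrt (1 + y\<^sup>2)"
  have p: "1 \<le> p" "p\<^sup>2 = 1 + x\<^sup>2" and q: "1 \<le> q" "q\<^sup>2 = 1 + y\<^sup>2"
    by (auto simp: p_def q_def)
  \<comment> \<open>Cauchy-Schwarz for the vectors (1, x) and (1, y), of lengths \<open>p\<close>
    and \<open>q\<close>.\<close>
  have "1 + x * y \<le> p * q"
  proof (rule power2_le_imp_le)
    have "(p * q)\<^sup>2 = (1 + x\<^sup>2) * (1 + y\<^sup>2)" by (simp add: power_mult_distrib p q)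
    also have "\<dots> = (1 + x * y)\<^sup>2 + (x - y)\<^sup>2" by algebra
    finally show "(1 + x * y)\<^sup>2 \<le> (p * q)\<^sup>2" by simp
  qed (use p q in simp)
  then have le1: "(1 + x * y) / (p * q) \<le> 1" using p q by (simp add: divide_simps)
  have sq: "(1 / p - 1 / q)\<^sup>2 \<ge> 0" by simp
  have xp: "x\<^sup>2 / p\<^sup>2 = 1 - 1 / p\<^sup>2" "y\<^sup>2 / q\<^sup>2 = 1 - 1 / q\<^sup>2"
    using p q by (auto simp: divide_simps)
  \<comment> \<open>The normalized vectors (1, x)/p and (1, y)/q have half squared distance one
    minus their inner product. Their second coordinates are \<open>squash x\<close> and
    \<open>squash y\<close>; dropping the contribution of the first coordinates gives the
    bound.\<close>
  have "(squash y - squash x)\<^sup>2 / 2 = (x\<^sup>2 / p\<^sup>2 + y\<^sup>2 / q\<^sup>2) / 2 - (x * y) / (p * q)"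
    unfolding squash_def p_def[symmetric] q_def[symmetric]
    by (simp add: power2_diff power_divide algebra_simps diff_divide_distrib add_divide_distrib)
  also have "\<dots> = 1 - (1 + x * y) / (p * q) - (1 / p - 1 / q)\<^sup>2 / 2"
    unfolding xp by (simp add: power2_eq_square algebra_simps add_divide_distrib diff_divide_distrib)
  also have "\<dots> \<le> 1 - (1 + x * y) / (p * q)" using sq by simp
  also have "\<dots> \<le> q * (1 - (1 + x * y) / (p * q))"
    using le1 q mult_right_mono[of 1 q "1 - (1 + x * y) / (p * q)"] by simp
  also have "\<dots> = q - (1 + x * y) / p" using q by (simp add: right_diff_distrib)
  also have "\<dots> = q - p - squash x * (y - x)"
  proof -
    have "p = (1 + x\<^sup>2) / p" using p by (simp add: power2_eq_square divide_simps)
    then have "q - p - squash x * (y - x) = q - (1 + x\<^sup>2) / p - x / p * (y - x)"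
      by (simp add: squash_def p_def)
    also have "\<dots> = q - (1 + x * y) / p"
      by (simp add: power2_eq_square algebra_simps add_divide_distrib diff_divide_distrib)
    finally show ?thesis by simp
  qed
  finally show ?thesis by (simp add: p_def q_def)
qed

lemma squash_has_derivative: "(squash has_real_derivative 1 / (sqrt (1 + x\<^sup>2)) ^ 3) (at x)"
proof -
  have "1 + x\<^sup>2 > 0" by (simp add: add_pos_nonneg)
  then show ?thesis
    unfolding squash_def
    by (auto intro!: derivative_eq_intros simp: divide_simps power2_eq_square power3_eq_cube)
qed

lemma squash_lipschitz: "\<bar>squash y - squash x\<bar> \<le> \<bar>y - x\<bar>"
proof -
  have "norm (squash y - squash x) \<le> 1 * norm (y - x)"
  proof (rule field_differentiable_bound[where S = UNIV])
    fix z :: real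
    show "(squash has_field_derivative 1 / (sqrt (1 + z\<^sup>2)) ^ 3) (at z within UNIV)"
      using squash_has_derivative by simp
    show "norm (1 / (sqrt (1 + z\<^sup>2)) ^ 3) \<le> 1"
      by (simp add: divide_le_eq_1 add_pos_nonneg)
  qed auto
  then show ?thesis by simp
qed

section \<open>Convergence of \<open>L\<^sub>1\<close>-bounded martingales in measure\<close>

lemma squash_LIMSEQ_D:
  assumes "(\<lambda>n. squash (u n)) \<longlonglongrightarrow> \<sigma>" "\<bar>\<sigma>\<bar> < 1"
  shows "u \<longlonglongrightarrow> \<sigma> / sqrt (1 - \<sigma>\<^sup>2)"
proof -
  have "\<sigma>\<^sup>2 < 1" using assms(2) by (simp add: abs_square_less_1)
  then have "(\<lambda>n. squash (u n) / sqrt (1 - (squash (u n))\<^sup>2)) \<longlonglongrightarrow> \<sigma> / sqrt (1 - \<sigma>\<^sup>2)"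
    by (intro tendsto_intros assms(1)) auto
  then show ?thesis by (simp add: unsquash)
qed

lemma squash_LIMSEQ_cancel:
  assumes "(\<lambda>n. squash (u n)) \<longlonglongrightarrow> squash l"
  shows "u \<longlonglongrightarrow> l"
  using squash_LIMSEQ_D[OF assms abs_squash_less_1] by (simp add: unsquash)

text \<open>The case of a limit at an endpoint: \<open>1 - (squash x)\<^sup>2\<close> is the
  reciprocal of \<open>1 + x\<^sup>2\<close>, so it can tend to 0 only if the squares grow without
  bound. Fatou's lemma later excludes this almost everywhere.\<close>

lemma squash_LIMSEQ_infinity:
  assumes "(\<lambda>n. squash (u n)) \<longlonglongrightarrow> \<sigma>" "\<bar>\<sigma>\<bar> = 1"
  shows "filterlim (\<lambda>n. \<bar>u n\<bar>) at_top sequentially"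
proof -
  have "(\<lambda>n. 1 - (squash (u n))\<^sup>2) \<longlonglongrightarrow> 1 - \<sigma>\<^sup>2"
    by (intro tendsto_intros assms(1))
  also have "1 - \<sigma>\<^sup>2 = 0" using assms(2) by (simp add: abs_square_eq_1)
  finally have lim: "(\<lambda>n. 1 - (squash (u n))\<^sup>2) \<longlonglongrightarrow> 0" .
  have eq: "1 - (squash x)\<^sup>2 = inverse (1 + x\<^sup>2)" for x
    by (simp add: squash_def power_divide field_simps add_nonneg_eq_0_iff)
  have "filterlim (\<lambda>n. inverse (inverse (1 + (u n)\<^sup>2))) at_top sequentially"
    using lim unfolding eq
    by (rule filterlim_inverse_at_top) (auto intro!: always_eventually add_pos_nonneg)
  then have inf: "filterlim (\<lambda>n. 1 + (u n)\<^sup>2) at_top sequentially" by simp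
  show ?thesis
    unfolding filterlim_at_top
  proof
    fix Z :: real
    have "\<forall>\<^sub>F n in sequentially. 1 + \<bar>Z\<bar>\<^sup>2 \<le> 1 + (u n)\<^sup>2"
      using inf unfolding filterlim_at_top by blast
    then show "\<forall>\<^sub>F n in sequentially. Z \<le> \<bar>u n\<bar>"
    proof eventually_elim
      case (elim n)
      then have "\<bar>Z\<bar> \<le> \<bar>u n\<bar>" by (simp add: abs_le_square_iff)
      then show ?case by simp
    qed
  qed
qed

text \<open>On a finite measure space this is convergence in measure.\<close>

definition squash_tendsto :: "'a measure \<Rightarrow> (nat \<Rightarrow> 'a \<Rightarrow> real) \<Rightarrow> ('a \<Rightarrow> real) \<Rightarrow> bool" where
  "squash_tendsto M X g \<longleftrightarrow> (\<lambda>k. LINT x|M. \<bar>squash (X k x) - squash (g x)\<bar>) \<longlonglongrightarrow> 0"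

context finite_measure
begin

lemma integrable_squash [simp]: "f \<in> borel_measurable M \<Longrightarrow> integrable M (\<lambda>x. squash (f x))"
  by (rule integrable_const_bound[where B = 1]) (auto intro!: less_imp_le[OF abs_squash_less_1])

lemma squash_tendsto_L1:
  assumes "\<And>k. integrable M (X k)" "integrable M g"
    and "(\<lambda>k. LINT x|M. \<bar>X k x - g x\<bar>) \<longlonglongrightarrow> 0"
  shows "squash_tendsto M X g"
  unfolding squash_tendsto_def
proof (rule tendsto_sandwich[OF _ _ tendsto_const assms(3)])
  show "\<forall>\<^sub>F k in sequentially. (LINT x|M. \<bar>squash (X k x) - squash (g x)\<bar>) \<le> (LINT x|M. \<bar>X k x - g x\<bar>)"
    using assms(1,2) by (intro always_eventually allI integral_mono) (auto simp: squash_lipschitz)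
qed auto

text \<open>An L1 null sequence has a subsequence that vanishes almost everywhere. Adding the three
  distances into \<open>w\<close> makes one subsequence serve all three sequences, and uniqueness of
  pointwise limits finishes.\<close>

lemma squash_tendsto_linear:
  assumes [measurable]: "\<And>k. X k \<in> borel_measurable M" "\<And>k. Y k \<in> borel_measurable M"
      "\<And>k. Z k \<in> borel_measurable M"
      "g \<in> borel_measurable M" "h \<in> borel_measurable M" "r \<in> borel_measurable M"
    and lim: "squash_tendsto M X g" "squash_tendsto M Y h" "squash_tendsto M Z r"
    and Z: "\<And>k x. Z k x = \<alpha> * X k x + \<beta> * Y k x"
  shows "AE x in M. r x = \<alpha> * g x + \<beta> * h x"
proof -
  define w where "w k x = \<bar>squash (X k x) - squash (g x)\<bar> + \<bar>squash (Y k x) - squash (h x)\<bar>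
     + \<bar>squash (Z k x) - squash (r x)\<bar>" for k x
  have int: "integrable M (w k)" for k unfolding w_def by simp
  have "(\<lambda>k. LINT x|M. w k x) \<longlonglongrightarrow> 0"
    using tendsto_add[OF tendsto_add[OF lim(1,2)[unfolded squash_tendsto_def]]
        lim(3)[unfolded squash_tendsto_def]]
    unfolding w_def by simp
  moreover have "norm (w k x) = w k x" for k x by (simp add: w_def)
  ultimately have "(\<lambda>k. LINT x|M. norm (w k x)) \<longlonglongrightarrow> 0" by simp
  then obtain s where s: "strict_mono s" "AE x in M. (\<lambda>n. w (s n) x) \<longlonglongrightarrow> 0"
    using tendsto_L1_AE_subseq[of M w] int by blast
  from s(2) show ?thesis
  proof eventually_elim
    case (elim x)
    have *: "(\<lambda>n. V (s n) x) \<longlonglongrightarrow> v x" if "\<And>n. \<bar>squash (V n x) - squash (v x)\<bar> \<le> w n x"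
      for V :: "nat \<Rightarrow> 'a \<Rightarrow> real" and v
    proof -
      have "(\<lambda>n. squash (V (s n) x) - squash (v x)) \<longlonglongrightarrow> 0"
        by (rule Lim_null_comparison[OF _ elim]) (simp add: that)
      then show ?thesis by (rule squash_LIMSEQ_cancel[OF LIM_zero_cancel])
    qed
    have "(\<lambda>n. Z (s n) x) \<longlonglongrightarrow> r x" "(\<lambda>n. X (s n) x) \<longlonglongrightarrow> g x" "(\<lambda>n. Y (s n) x) \<longlonglongrightarrow> h x"
      by (rule *; simp add: w_def)+
    then have "(\<lambda>n. Z (s n) x) \<longlonglongrightarrow> \<alpha> * g x + \<beta> * h x"
      unfolding Z by (intro tendsto_intros)
    with \<open>(\<lambda>n. Z (s n) x) \<longlonglongrightarrow> r x\<close> show ?case by (rule LIMSEQ_unique)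
  qed
qed

lemma squash_tendsto_unique:
  assumes "\<And>k. X k \<in> borel_measurable M" "g \<in> borel_measurable M" "h \<in> borel_measurable M"
    and "squash_tendsto M X g" "squash_tendsto M X h"
  shows "AE x in M. g x = h x"
  using squash_tendsto_linear[of X X X h h g 1 0] assms by simp

text \<open>The inequality between arithmetic and geometric mean, integrated. It takes the place of
  Cauchy-Schwarz in passing from small L2 distance to small L1 distance, with \<open>t\<close> free
  to balance the two terms.\<close>

lemma integral_abs_le_half:
  assumes "d \<in> borel_measurable M" "integrable M (\<lambda>x. (d x)\<^sup>2)" "t > 0"
  shows "(LINT x|M. \<bar>d x\<bar>) \<le> (t * measure M (space M) + (LINT x|M. (d x)\<^sup>2) / t) / 2"
proof -
  have "(LINT x|M. \<bar>d x\<bar>) \<le> (LINT x|M. (t + (d x)\<^sup>2 / t) / 2)"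
  proof (rule integral_mono')
    fix x
    have "0 \<le> (t - \<bar>d x\<bar>)\<^sup>2" by simp
    then have "2 * t * \<bar>d x\<bar> \<le> t * t + (d x)\<^sup>2"
      by (simp add: power2_eq_square algebra_simps)
    then show "\<bar>d x\<bar> \<le> (t + (d x)\<^sup>2 / t) / 2"
      using assms(3) by (simp add: field_simps)
    show "0 \<le> (t + (d x)\<^sup>2 / t) / 2" using assms(3) by simp
  qed (use assms in auto)
  also have "\<dots> = (t * measure M (space M) + (LINT x|M. (d x)\<^sup>2) / t) / 2"
    using assms by simp
  finally show ?thesis .
qed

text \<open>The martingale property enters as \<open>mart\<close>: increments are orthogonal to
  \<open>squash (X k)\<close>, a function of the past. This product is the linear term of the
  Bregman distance, so integrating \<open>squash_bregman\<close> leaves only the increment of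
  \<open>\<phi>\<close>.\<close>

lemma L1_bounded_martingale_converges:
  assumes int [simp]: "\<And>k. integrable M (X k)"
    and bnd: "\<And>k. (LINT x|M. \<bar>X k x\<bar>) \<le> B"
    and mart: "\<And>k l. k \<le> l \<Longrightarrow> (LINT x|M. squash (X k x) * (X l x - X k x)) = 0"
  shows "\<exists>g. integrable M g \<and> (LINT x|M. \<bar>g x\<bar>) \<le> B \<and> squash_tendsto M X g"
proof -
  have [measurable]: "X k \<in> borel_measurable M" for k using int by blast
  define m where "m = measure M (space M)"
  define \<phi> where "\<phi> k = (LINT x|M. sqrt (1 + (X k x)\<^sup>2))" for k
  have sqrt_le: "sqrt (1 + y\<^sup>2) \<le> 1 + \<bar>y\<bar>" for y :: real
    by (rule real_le_lsqrt) (auto simp: power2_eq_square algebra_simps)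
  have int_phi [simp]: "integrable M (\<lambda>x. sqrt (1 + (X k x)\<^sup>2))" for k
  proof (rule Bochner_Integration.integrable_bound)
    show "integrable M (\<lambda>x. 1 + \<bar>X k x\<bar>)" by simp
  qed (auto simp: sqrt_le intro!: always_eventually order_trans[OF sqrt_le])
  have int_mul [simp]: "integrable M (\<lambda>x. squash (X k x) * (X l x - X k x))" for k l
  proof (rule Bochner_Integration.integrable_bound)
    show "integrable M (\<lambda>x. X l x - X k x)" by simp
    show "AE x in M. norm (squash (X k x) * (X l x - X k x)) \<le> norm (X l x - X k x)"
      using abs_squash_less_1
      by (auto simp: abs_mult intro!: always_eventually mult_left_le_one_le
          less_imp_le[OF abs_squash_less_1])
  qed simp
  have int_sq [simp]: "integrable M (\<lambda>x. (squash (X l x) - squash (X k x))\<^sup>2)" for k l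
  proof (rule integrable_const_bound[where B = 4])
    have "\<bar>squash (X l x) - squash (X k x)\<bar> \<le> 2" for x
      using abs_squash_less_1[of "X l x"] abs_squash_less_1[of "X k x"] by linarith
    then have "(squash (X l x) - squash (X k x))\<^sup>2 \<le> 2\<^sup>2" for x
      by (simp only: abs_le_square_iff[symmetric]) simp
    then show "AE x in M. norm ((squash (X l x) - squash (X k x))\<^sup>2) \<le> 4" by simp
  qed simp
  have breg: "(LINT x|M. (squash (X l x) - squash (X k x))\<^sup>2) \<le> 2 * (\<phi> l - \<phi> k)" if "k \<le> l" for k l
  proof -
    have "(LINT x|M. (squash (X l x) - squash (X k x))\<^sup>2 / 2)
      \<le> (LINT x|M. sqrt (1 + (X l x)\<^sup>2) - sqrt (1 + (X k x)\<^sup>2) - squash (X k x) * (X l x - X k x))"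
      by (intro integral_mono squash_bregman) auto
    also have "\<dots> = \<phi> l - \<phi> k"
      using mart[OF that] by (simp add: \<phi>_def)
    finally show ?thesis by simp
  qed
  have "\<phi> k \<le> \<phi> l" if "k \<le> l" for k l
  proof -
    have "0 \<le> (LINT x|M. (squash (X l x) - squash (X k x))\<^sup>2)" by simp
    from order_trans[OF this breg[OF that]] show ?thesis by simp
  qed
  then have "incseq \<phi>" by (simp add: incseq_def)
  moreover have "\<phi> k \<le> m + B" for k
  proof -
    have "\<phi> k \<le> (LINT x|M. 1 + \<bar>X k x\<bar>)"
      unfolding \<phi>_def by (intro integral_mono sqrt_le) auto
    also have "\<dots> \<le> m + B" using bnd[of k] by (simp add: m_def)
    finally show ?thesis .
  qed
  ultimately have "convergent \<phi>"
    by (metis incseq_convergent convergentI)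
  then have Cphi: "Cauchy \<phi>" by (simp add: Cauchy_convergent_iff)
  have cau: "\<exists>N. \<forall>i\<ge>N. \<forall>j\<ge>N. (LINT x|M. norm (squash (X i x) - squash (X j x))) < e"
    if "e > 0" for e :: real
  proof -
    \<comment> \<open>\<open>integral_abs_le_half\<close> bounds the L1 distance by the mean of
      \<open>t * m\<close> and a squared L2 distance divided by \<open>t\<close>. This
      \<open>t\<close> keeps the first below \<open>e\<close>, the \<open>+ 1\<close> also covering
      \<open>m = 0\<close>; values of \<open>\<phi>\<close> within \<open>e * t / 2\<close> of each
      other keep the second below \<open>e\<close>.\<close>
    define t where "t = e / (m + 1)"
    have m0: "m \<ge> 0" by (simp add: m_def)
    then have t: "t > 0" "t * m < e" using that by (auto simp: t_def field_simps)
    have "e * t / 2 > 0" using t that by simp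
    then obtain N where N: "\<And>i j. i \<ge> N \<Longrightarrow> j \<ge> N \<Longrightarrow> dist (\<phi> i) (\<phi> j) < e * t / 2"
      using Cphi unfolding Cauchy_def by blast
    have main: "(LINT x|M. \<bar>squash (X l x) - squash (X k x)\<bar>) < e" if "N \<le> k" "k \<le> l" for k l
    proof -
      have "2 * (\<phi> l - \<phi> k) < e * t"
        using N[of l k] that abs_ge_self[of "\<phi> l - \<phi> k"] unfolding dist_real_def by (simp add: field_simps)
      then have sq: "(LINT x|M. (squash (X l x) - squash (X k x))\<^sup>2) / t < e"
        using breg[OF that(2)] t by (simp add: divide_less_eq)
      have "(LINT x|M. \<bar>squash (X l x) - squash (X k x)\<bar>)
          \<le> (t * m + (LINT x|M. (squash (X l x) - squash (X k x))\<^sup>2) / t) / 2"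
        unfolding m_def by (rule integral_abs_le_half) (use t in auto)
      also have "\<dots> < e" using sq t by simp
      finally show ?thesis .
    qed
    have "(LINT x|M. norm (squash (X i x) - squash (X j x))) < e" if "i \<ge> N" "j \<ge> N" for i j
      using main[of i j] main[of j i] that by (cases "i \<le> j") (simp_all add: abs_minus_commute)
    then show ?thesis by blast
  qed
  obtain r where r: "strict_mono r" "AE x in M. Cauchy (\<lambda>i. squash (X (r i) x))"
    by (rule cauchy_L1_AE_cauchy_subseq[of M "\<lambda>k x. squash (X k x)", OF _ cau]) auto
  define \<sigma> where "\<sigma> x = lim (\<lambda>i. squash (X (r i) x))" for x
  have [measurable]: "\<sigma> \<in> borel_measurable M" unfolding \<sigma>_def by measurable
  have lim\<sigma>: "AE x in M. (\<lambda>i. squash (X (r i) x)) \<longlonglongrightarrow> \<sigma> x"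
    using r(2) by eventually_elim (simp add: \<sigma>_def Cauchy_convergent_iff convergent_LIMSEQ_iff)
  have B0: "B \<ge> 0" by (rule order_trans[OF _ bnd[of 0]]) simp
  have nnb: "(\<integral>\<^sup>+x. ennreal \<bar>X k x\<bar> \<partial>M) \<le> ennreal B" for k
    using bnd[of k] by (subst nn_integral_eq_integral) (auto intro: ennreal_leI)
  have "(\<integral>\<^sup>+x. liminf (\<lambda>i. ennreal \<bar>X (r i) x\<bar>) \<partial>M) \<le> liminf (\<lambda>i. \<integral>\<^sup>+x. ennreal \<bar>X (r i) x\<bar> \<partial>M)"
    by (rule nn_integral_liminf) simp
  also have "\<dots> \<le> ennreal B"
    by (rule order_trans[OF Liminf_le_Limsup]) (auto intro!: Limsup_bounded always_eventually nnb)
  finally have fatou: "(\<integral>\<^sup>+x. liminf (\<lambda>i. ennreal \<bar>X (r i) x\<bar>) \<partial>M) \<le> ennreal B" .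
  then have "AE x in M. liminf (\<lambda>i. ennreal \<bar>X (r i) x\<bar>) \<noteq> \<infinity>"
    by (intro nn_integral_PInf_AE) (auto simp: top_unique)
  \<comment> \<open>A limit at an endpoint would drive \<open>\<bar>X (r i) x\<bar>\<close> to
    infinity, against the lower limit that Fatou's lemma makes finite almost everywhere.\<close>
  then have ae\<sigma>: "AE x in M. \<bar>\<sigma> x\<bar> < 1"
    using lim\<sigma>
  proof eventually_elim
    case (elim x)
    have "\<bar>\<sigma> x\<bar> \<le> 1"
      by (rule LIMSEQ_le_const2[OF tendsto_rabs[OF elim(2)]])
        (auto intro!: less_imp_le abs_squash_less_1)
    moreover have "\<bar>\<sigma> x\<bar> \<noteq> 1"
    proof
      assume "\<bar>\<sigma> x\<bar> = 1"
      then have "filterlim (\<lambda>n. \<bar>X (r n) x\<bar>) at_top sequentially"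
        using elim(2) by (rule squash_LIMSEQ_infinity[rotated])
      then have "(\<lambda>n. ennreal \<bar>X (r n) x\<bar>) \<longlonglongrightarrow> \<infinity>"
        by (simp add: ennreal_tendsto_top_eq_at_top)
      then have "liminf (\<lambda>i. ennreal \<bar>X (r i) x\<bar>) = \<infinity>"
        by (intro lim_imp_Liminf) auto
      with elim(1) show False by simp
    qed
    ultimately show ?case by simp
  qed
  define g where "g x = \<sigma> x / sqrt (1 - (\<sigma> x)\<^sup>2)" for x
  have [measurable]: "g \<in> borel_measurable M" unfolding g_def by measurable
  have limg: "AE x in M. (\<lambda>i. X (r i) x) \<longlonglongrightarrow> g x"
    using lim\<sigma> ae\<sigma> by eventually_elim (simp add: g_def squash_LIMSEQ_D)
  have "(\<integral>\<^sup>+x. ennreal \<bar>g x\<bar> \<partial>M) = (\<integral>\<^sup>+x. liminf (\<lambda>i. ennreal \<bar>X (r i) x\<bar>) \<partial>M)"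
  proof (rule nn_integral_cong_AE)
    show "AE x in M. ennreal \<bar>g x\<bar> = liminf (\<lambda>i. ennreal \<bar>X (r i) x\<bar>)"
      using limg
    proof eventually_elim
      case (elim x)
      then have "(\<lambda>i. ennreal \<bar>X (r i) x\<bar>) \<longlonglongrightarrow> ennreal \<bar>g x\<bar>"
        by (intro tendsto_ennrealI tendsto_rabs)
      then show ?case by (intro lim_imp_Liminf[symmetric]) auto
    qed
  qed
  with fatou have gB: "(\<integral>\<^sup>+x. ennreal \<bar>g x\<bar> \<partial>M) \<le> ennreal B" by simp
  have gint: "integrable M g"
    by (rule integrableI_bounded) (use gB in \<open>auto intro: le_less_trans\<close>)
  have "ennreal (LINT x|M. \<bar>g x\<bar>) \<le> ennreal B"
    using gB gint by (subst nn_integral_eq_integral[symmetric]) auto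
  then have "(LINT x|M. \<bar>g x\<bar>) \<le> B" using B0 by simp
  moreover have "squash_tendsto M X g"
  proof -
    have sub: "(\<lambda>i. LINT x|M. \<bar>squash (X (r i) x) - squash (g x)\<bar>) \<longlonglongrightarrow> (LINT x|M. 0)"
    proof (rule integral_dominated_convergence[where w = "\<lambda>_. 2"])
      have cont: "isCont squash y" for y using squash_has_derivative DERIV_isCont by blast
      show "AE x in M. (\<lambda>i. \<bar>squash (X (r i) x) - squash (g x)\<bar>) \<longlonglongrightarrow> 0"
        using limg
      proof eventually_elim
        case (elim x)
        then show ?case
          by (intro tendsto_rabs_zero LIM_zero isCont_tendsto_compose[OF cont])
      qed
      show "AE x in M. norm \<bar>squash (X (r i) x) - squash (g x)\<bar> \<le> 2" for i
      proof (rule AE_I2)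
        fix x show "norm \<bar>squash (X (r i) x) - squash (g x)\<bar> \<le> 2"
          using abs_squash_less_1[of "X (r i) x"] abs_squash_less_1[of "g x"] by simp
      qed
    qed auto
    \<comment> \<open>So far only a subsequence converges; the Cauchy property \<open>cau\<close>
      carries the limit over to the whole sequence.\<close>
    show ?thesis
      unfolding squash_tendsto_def
    proof (rule LIMSEQ_I)
      fix e :: real assume "e > 0"
      obtain N where N: "\<And>i j. i \<ge> N \<Longrightarrow> j \<ge> N \<Longrightarrow> (LINT x|M. norm (squash (X i x) - squash (X j x))) < e / 2"
        using cau[of "e / 2"] \<open>e > 0\<close> by auto
      obtain K where K: "\<And>i. i \<ge> K \<Longrightarrow> (LINT x|M. \<bar>squash (X (r i) x) - squash (g x)\<bar>) < e / 2"
        using LIMSEQ_D[OF sub, of "e / 2"] \<open>e > 0\<close> by auto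
      define j where "j = max N K"
      have rj: "r j \<ge> N" using seq_suble[OF r(1), of j] by (simp add: j_def)
      have "norm ((LINT x|M. \<bar>squash (X k x) - squash (g x)\<bar>) - 0) < e" if "k \<ge> N" for k
      proof -
        have "(LINT x|M. \<bar>squash (X k x) - squash (g x)\<bar>)
           \<le> (LINT x|M. norm (squash (X k x) - squash (X (r j) x)) + \<bar>squash (X (r j) x) - squash (g x)\<bar>)"
          by (intro integral_mono) auto
        also have "\<dots> = (LINT x|M. norm (squash (X k x) - squash (X (r j) x)))
            + (LINT x|M. \<bar>squash (X (r j) x) - squash (g x)\<bar>)"
          by (intro Bochner_Integration.integral_add) auto
        also have "\<dots> < e" using N[OF that rj] K[of j] by (simp add: j_def)
        finally show ?thesis by simp
      qed
      then show "\<exists>no. \<forall>n\<ge>no. norm ((LINT x|M. \<bar>squash (X n x) - squash (g x)\<bar>) - 0) < e" by blast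
    qed
  qed
  ultimately show ?thesis using gint by blast
qed

end

section \<open>Dyadic difference quotients\<close>

abbreviation unit_lebesgue :: "real measure" where
  "unit_lebesgue \<equiv> lebesgue_on {0..1}"

interpretation unit: finite_measure unit_lebesgue
  by (rule finite_measure_lebesgue_on) simp

text \<open>The number of the half-open dyadic interval of level \<open>k\<close> that contains
  \<open>x\<close>. At \<open>x = 1\<close> it is \<open>2 ^ k\<close>, one past the last interval,
  which is why the point 1 is set aside as a null set below.\<close>

definition dyadic_index :: "nat \<Rightarrow> real \<Rightarrow> nat" where
  "dyadic_index k x = nat \<lfloor>2 ^ k * x\<rfloor>"

definition dyadic_quotient :: "(real \<Rightarrow> real) \<Rightarrow> nat \<Rightarrow> nat \<Rightarrow> real" where
  "dyadic_quotient F k j = 2 ^ k * (F (real (Suc j) / 2 ^ k) - F (real j / 2 ^ k))"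

text \<open>When \<open>F\<close> is the distribution function of a measure, this is its mean
  density on the dyadic interval around \<open>x\<close>.\<close>

definition dyadic_deriv :: "(real \<Rightarrow> real) \<Rightarrow> nat \<Rightarrow> real \<Rightarrow> real" where
  "dyadic_deriv F k x = dyadic_quotient F k (dyadic_index k x)"

lemma borel_measurable_unit_lebesgue:
  "f \<in> borel_measurable borel \<Longrightarrow> f \<in> borel_measurable unit_lebesgue"
  by (intro measurable_restrict_space1 measurable_completion) simp

lemma AE_unit_lebesgue_not_1: "AE x in unit_lebesgue. x \<noteq> 1"
proof -
  have "AE x in lebesgue. x \<noteq> (1::real)"
    using AE_not_in[of "{1::real}" lebesgue] by (simp add: negligible_iff_null_sets[symmetric])
  then have "AE x in lebesgue. x \<in> {0..1} \<longrightarrow> x \<noteq> (1::real)" by eventually_elim simp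
  then show ?thesis by (simp add: AE_restrict_space_iff)
qed

lemma dyadic_index_eq_iff:
  assumes "0 \<le> x"
  shows "dyadic_index k x = j \<longleftrightarrow> real j / 2 ^ k \<le> x \<and> x < real (Suc j) / 2 ^ k"
proof -
  have "dyadic_index k x = j \<longleftrightarrow> \<lfloor>2 ^ k * x\<rfloor> = int j"
    using assms by (auto simp: dyadic_index_def)
  also have "\<dots> \<longleftrightarrow> real j \<le> 2 ^ k * x \<and> 2 ^ k * x < real (Suc j)"
    by (simp add: floor_eq_iff add.commute)
  also have "\<dots> \<longleftrightarrow> real j / 2 ^ k \<le> x \<and> x < real (Suc j) / 2 ^ k"
    by (simp add: field_simps)
  finally show ?thesis .
qed

lemma dyadic_index_less:
  assumes "0 \<le> x" "x < 1"
  shows "dyadic_index k x < 2 ^ k"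
proof -
  have "\<lfloor>2 ^ k * x\<rfloor> < 2 ^ k"
    using assms by (simp add: floor_less_iff)
  then show ?thesis by (simp add: dyadic_index_def nat_less_iff)
qed

text \<open>Nesting of the dyadic intervals: passing to the coarser level drops the last
  \<open>l - k\<close> binary digits of the index.\<close>

lemma dyadic_index_div:
  assumes "k \<le> l" "0 \<le> x"
  shows "dyadic_index k x = dyadic_index l x div 2 ^ (l - k)"
proof -
  have "2 ^ k * x = 2 ^ l * x / real_of_int (2 ^ (l - k))"
    using assms(1) by (simp add: power_add[symmetric] divide_eq_eq eq_divide_eq)
  then have "\<lfloor>2 ^ k * x\<rfloor> = \<lfloor>2 ^ l * x\<rfloor> div 2 ^ (l - k)"
    using floor_divide_real_eq_div[of "2 ^ (l - k)" "2 ^ l * x"] by simp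
  then show ?thesis
    using assms(2) by (simp add: dyadic_index_def nat_div_distrib nat_power_eq)
qed

text \<open>Off the null set where \<open>x = 1\<close>, the function is a finite combination of
  indicators of intervals of length \<open>1 / 2 ^ k\<close>. Integrals of dyadic step functions
  thereby become finite sums.\<close>

lemma dyadic_step:
  fixes u :: "nat \<Rightarrow> real"
  shows integrable_dyadic_step: "integrable unit_lebesgue (\<lambda>x. u (dyadic_index k x))"
    and integral_dyadic_step: "(LINT x|unit_lebesgue. u (dyadic_index k x)) = (\<Sum>j<2 ^ k. u j) / 2 ^ k"
proof -
  let ?I = "\<lambda>j. {real j / 2 ^ k ..< real (Suc j) / 2 ^ k}"
  let ?v = "\<lambda>x. \<Sum>j<2 ^ k. u j * indicator (?I j) x"
  have "(\<lambda>x. u (dyadic_index k x)) \<in> borel_measurable borel"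
    unfolding dyadic_index_def by measurable
  then have m1: "(\<lambda>x. u (dyadic_index k x)) \<in> borel_measurable unit_lebesgue"
    by (rule borel_measurable_unit_lebesgue)
  have m2: "?v \<in> borel_measurable unit_lebesgue"
    by (rule borel_measurable_unit_lebesgue) measurable
  have eq: "AE x in unit_lebesgue. u (dyadic_index k x) = ?v x"
    using AE_unit_lebesgue_not_1 AE_space
  proof eventually_elim
    case (elim x)
    then have x: "0 \<le> x" "x < 1" by auto
    have "?v x = (\<Sum>j<2 ^ k. if j = dyadic_index k x then u j else 0)"
    proof (rule sum.cong[OF refl])
      fix j
      show "u j * indicator (?I j) x = (if j = dyadic_index k x then u j else 0)"
        using dyadic_index_eq_iff[OF x(1), of k j] by (auto simp: indicator_def)
    qed
    also have "\<dots> = u (dyadic_index k x)" using dyadic_index_less[OF x] by simp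
    finally show ?case by simp
  qed
  have I: "?I j \<subseteq> {0..1}" if "j < 2 ^ k" for j
  proof -
    have "real (Suc j) \<le> 2 ^ k" using that by (metis Suc_leI of_nat_le_iff of_nat_numeral of_nat_power)
    then have "real (Suc j) / 2 ^ k \<le> 1" by (simp add: divide_simps)
    moreover have "0 \<le> real j / 2 ^ k" by simp
    ultimately show ?thesis
      unfolding subset_iff atLeastLessThan_iff atLeastAtMost_iff by (meson order_trans less_imp_le)
  qed
  have meas: "measure unit_lebesgue (?I j) = 1 / 2 ^ k" if "j < 2 ^ k" for j
    using I[OF that] by (simp add: measure_restrict_space divide_right_mono diff_divide_distrib[symmetric])
  have sets: "?I j \<in> sets unit_lebesgue" if "j < 2 ^ k" for j
    using I[OF that] by (simp add: sets_restrict_space_iff)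
  have int: "integrable unit_lebesgue (indicator (?I j) :: real \<Rightarrow> real)" if "j < 2 ^ k" for j
    using sets[OF that] by (simp add: less_top[symmetric])
  have intv: "integrable unit_lebesgue ?v"
    by (intro Bochner_Integration.integrable_sum integrable_mult_right int) simp
  then show "integrable unit_lebesgue (\<lambda>x. u (dyadic_index k x))"
    using integrable_cong_AE[OF m1 m2 eq] by simp
  have "(LINT x|unit_lebesgue. u (dyadic_index k x)) = (LINT x|unit_lebesgue. ?v x)"
    by (rule integral_cong_AE[OF m1 m2 eq])
  also have "\<dots> = (\<Sum>j<2 ^ k. LINT x|unit_lebesgue. u j * indicator (?I j) x)"
    using int by (intro Bochner_Integration.integral_sum) auto
  also have "\<dots> = (\<Sum>j<2 ^ k. u j / 2 ^ k)"
  proof (rule sum.cong[OF refl])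
    fix j :: nat assume "j \<in> {..<2 ^ k}"
    then have j: "j < 2 ^ k" by simp
    have "?I j \<inter> {0..1} = ?I j" using I[OF j] by blast
    then show "(LINT x|unit_lebesgue. u j * indicator (?I j) x) = u j / 2 ^ k"
      using meas[OF j] by (simp del: of_nat_Suc)
  qed
  finally show "(LINT x|unit_lebesgue. u (dyadic_index k x)) = (\<Sum>j<2 ^ k. u j) / 2 ^ k"
    by (simp add: sum_divide_distrib)
qed

lemma integrable_dyadic_deriv [simp]: "integrable unit_lebesgue (dyadic_deriv F k)"
  unfolding dyadic_deriv_def[abs_def] by (rule integrable_dyadic_step)

lemma integral_abs_dyadic_deriv:
  "(LINT x|unit_lebesgue. \<bar>dyadic_deriv F k x\<bar>) = (\<Sum>j<2 ^ k. \<bar>dyadic_quotient F k j\<bar>) / 2 ^ k"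
  unfolding dyadic_deriv_def by (rule integral_dyadic_step)

lemma sum_dyadic_quotient:
  assumes "m \<le> n"
  shows "(\<Sum>j=m..<n. dyadic_quotient F k j) = 2 ^ k * (F (real n / 2 ^ k) - F (real m / 2 ^ k))"
  unfolding dyadic_quotient_def sum_distrib_left[symmetric]
  using sum_Suc_diff'[OF assms, of "\<lambda>j. F (real j / 2 ^ k)"] by simp

text \<open>Group the level-\<open>l\<close> intervals by the level-\<open>k\<close> interval that
  contains them, \<open>d\<close> to a group. On a group the factor \<open>h\<close> is constant,
  while the fine quotients telescope to \<open>d\<close> times the coarse one.\<close>

lemma dyadic_deriv_martingale:
  assumes "k \<le> l"
  shows "(LINT x|unit_lebesgue. h (dyadic_deriv F k x) * (dyadic_deriv F l x - dyadic_deriv F k x)) = 0"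
proof -
  define d :: nat where "d = 2 ^ (l - k)"
  have d: "d > 0" "2 ^ l = 2 ^ k * d" "(2::real) ^ l = 2 ^ k * real d"
    using assms by (auto simp: d_def power_add[symmetric])
  define u where "u j = h (dyadic_quotient F k (j div d)) *
      (dyadic_quotient F l j - dyadic_quotient F k (j div d))" for j
  have "(LINT x|unit_lebesgue. h (dyadic_deriv F k x) * (dyadic_deriv F l x - dyadic_deriv F k x))
      = (LINT x|unit_lebesgue. u (dyadic_index l x))"
    by (rule Bochner_Integration.integral_cong)
       (auto simp: u_def dyadic_deriv_def dyadic_index_div[OF assms] d_def)
  also have "\<dots> = (\<Sum>j<2 ^ l. u j) / 2 ^ l" by (rule integral_dyadic_step)
  also have "(\<Sum>j<2 ^ l. u j) = (\<Sum>i<2 ^ k. sum u {i * d..<i * d + d})"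
    unfolding d(2) by (rule sum.nat_group[symmetric])
  also have "\<dots> = (\<Sum>i<2 ^ k :: nat. 0)"
  proof (rule sum.cong[OF refl])
    fix i
    have "sum u {i * d..<i * d + d} = (\<Sum>j=i * d..<i * d + d. h (dyadic_quotient F k i) *
      (dyadic_quotient F l j - dyadic_quotient F k i))"
    proof (rule sum.cong[OF refl])
      fix j assume "j \<in> {i * d..<i * d + d}"
      then have "j div d = i"
        by (intro div_nat_eqI) (auto simp: mult.commute)
      then show "u j = h (dyadic_quotient F k i) * (dyadic_quotient F l j - dyadic_quotient F k i)"
        by (simp add: u_def)
    qed
    also have "\<dots> = h (dyadic_quotient F k i) *
       ((\<Sum>j=i * d..<i * d + d. dyadic_quotient F l j) - real d * dyadic_quotient F k i)"
      by (simp add: sum_distrib_left[symmetric] sum_subtractf)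
    also have "(\<Sum>j=i * d..<i * d + d. dyadic_quotient F l j)
        = 2 ^ l * (F (real (i * d + d) / 2 ^ l) - F (real (i * d) / 2 ^ l))"
      by (rule sum_dyadic_quotient) simp
    also have "real (i * d + d) / 2 ^ l = real (Suc i) / 2 ^ k"
      unfolding d(3) using d(1) by (simp add: field_simps)
    also have "real (i * d) / 2 ^ l = real i / 2 ^ k"
      unfolding d(3) using d(1) by (simp add: field_simps)
    also have "2 ^ l * (F (real (Suc i) / 2 ^ k) - F (real i / 2 ^ k)) = real d * dyadic_quotient F k i"
      unfolding d(3) dyadic_quotient_def by simp
    finally show "sum u {i * d..<i * d + d} = 0" by simp
  qed
  finally show ?thesis by simp
qed

section \<open>Primitives of integrable functions and their dyadic averages\<close>

text \<open>The open ray makes differences of values integrals over half-open intervals, matching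
  \<open>dyadic_index\<close>. For integrable \<open>f\<close> the function is 0 up to 0 and
  constant from 1 on.\<close>

definition primitive :: "(real \<Rightarrow> real) \<Rightarrow> real \<Rightarrow> real" where
  "primitive f x = (LINT y|unit_lebesgue. f y * indicator {..<x} y)"

lemma integrable_mult_interval [simp]:
  fixes f :: "real \<Rightarrow> real"
  assumes "integrable unit_lebesgue f" "A \<in> sets borel"
  shows "integrable unit_lebesgue (\<lambda>y. f y * indicator A y)"
proof (rule Bochner_Integration.integrable_bound[OF assms(1)])
  have "(indicator A :: real \<Rightarrow> real) \<in> borel_measurable unit_lebesgue"
    using assms(2) by (intro borel_measurable_unit_lebesgue) simp
  then show "(\<lambda>y. f y * indicator A y) \<in> borel_measurable unit_lebesgue"
    using assms(1) by auto
qed (auto simp: indicator_def)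

lemma primitive_add:
  assumes "integrable unit_lebesgue f" "integrable unit_lebesgue g"
  shows "primitive (\<lambda>x. f x + g x) q = primitive f q + primitive g q"
  using assms by (simp add: primitive_def distrib_right)

lemma primitive_cmult: "primitive (\<lambda>x. c * f x) q = c * primitive f q"
  by (simp add: primitive_def mult.assoc)

lemma primitive_cong_AE:
  assumes "integrable unit_lebesgue f" "integrable unit_lebesgue g" "AE x in unit_lebesgue. f x = g x"
  shows "primitive f = primitive g"
proof
  fix q
  show "primitive f q = primitive g q"
    unfolding primitive_def
  proof (rule integral_cong_AE)
    show "AE y in unit_lebesgue. f y * indicator {..<q} y = g y * indicator {..<q} y"
      using assms(3) by eventually_elim simp
  qed (use assms in \<open>auto intro: borel_measurable_integrable\<close>)
qed

lemma primitive_diff: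
  assumes "integrable unit_lebesgue f" "p \<le> q"
  shows "primitive f q - primitive f p = (LINT y|unit_lebesgue. f y * indicator {p..<q} y)"
proof -
  have "primitive f q - primitive f p = (LINT y|unit_lebesgue. f y * indicator {..<q} y - f y * indicator {..<p} y)"
    using assms(1) by (simp add: primitive_def)
  also have "\<dots> = (LINT y|unit_lebesgue. f y * indicator {p..<q} y)"
    using assms(2) by (intro Bochner_Integration.integral_cong) (auto simp: indicator_def)
  finally show ?thesis .
qed

lemma primitive_0 [simp]: "primitive f 0 = 0"
proof -
  have "primitive f 0 = (LINT y|unit_lebesgue. 0)"
    unfolding primitive_def by (intro Bochner_Integration.integral_cong) (auto simp: indicator_def)
  then show ?thesis by simp
qed

lemma primitive_ge_1:
  assumes "integrable unit_lebesgue f" "1 \<le> q"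
  shows "primitive f q = (LINT y|unit_lebesgue. f y)"
  unfolding primitive_def
proof (rule integral_cong_AE)
  show "AE y in unit_lebesgue. f y * indicator {..<q} y = f y"
    using AE_unit_lebesgue_not_1 AE_space
    by eventually_elim (use assms(2) in \<open>auto simp: indicator_def\<close>)
qed (use assms in \<open>auto intro: borel_measurable_integrable\<close>)

lemma abs_primitive_diff_le:
  assumes "integrable unit_lebesgue f" "p \<le> q"
  shows "\<bar>primitive f q - primitive f p\<bar> \<le> primitive (\<lambda>x. \<bar>f x\<bar>) q - primitive (\<lambda>x. \<bar>f x\<bar>) p"
proof -
  have "\<bar>primitive f q - primitive f p\<bar> \<le> (LINT y|unit_lebesgue. \<bar>f y * indicator {p..<q} y\<bar>)"
    unfolding primitive_diff[OF assms] by (rule integral_abs_bound)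
  also have "\<dots> = (LINT y|unit_lebesgue. \<bar>f y\<bar> * indicator {p..<q} y)"
    by (intro Bochner_Integration.integral_cong) (auto simp: indicator_def)
  also have "\<dots> = primitive (\<lambda>x. \<bar>f x\<bar>) q - primitive (\<lambda>x. \<bar>f x\<bar>) p"
    by (rule primitive_diff[symmetric]) (use assms in auto)
  finally show ?thesis .
qed

lemma sum_dyadic_quotient_primitive:
  assumes "integrable unit_lebesgue f"
  shows "(\<Sum>j<2 ^ k. dyadic_quotient (primitive f) k j) = 2 ^ k * (LINT x|unit_lebesgue. f x)"
  using sum_dyadic_quotient[of 0 "2 ^ k" "primitive f" k] primitive_ge_1[OF assms, of 1]
  by (simp add: atLeast0LessThan)

lemma sum_abs_dyadic_quotient_primitive:
  assumes "integrable unit_lebesgue f"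
  shows "(\<Sum>j<2 ^ k. \<bar>dyadic_quotient (primitive f) k j\<bar>) \<le> 2 ^ k * (LINT x|unit_lebesgue. \<bar>f x\<bar>)"
proof -
  have "(\<Sum>j<2 ^ k. \<bar>dyadic_quotient (primitive f) k j\<bar>)
      \<le> (\<Sum>j<2 ^ k. dyadic_quotient (primitive (\<lambda>x. \<bar>f x\<bar>)) k j)"
    unfolding dyadic_quotient_def abs_mult
    by (intro sum_mono) (simp add: abs_primitive_diff_le[OF assms] divide_right_mono)
  also have "\<dots> = 2 ^ k * (LINT x|unit_lebesgue. \<bar>f x\<bar>)"
    using assms by (intro sum_dyadic_quotient_primitive) simp
  finally show ?thesis .
qed

lemma dyadic_deriv_primitive_contraction:
  assumes "integrable unit_lebesgue f"
  shows "(LINT x|unit_lebesgue. \<bar>dyadic_deriv (primitive f) k x\<bar>) \<le> (LINT x|unit_lebesgue. \<bar>f x\<bar>)"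
  using sum_abs_dyadic_quotient_primitive[OF assms, of k]
  by (simp add: integral_abs_dyadic_deriv divide_le_eq mult.commute)

lemma dyadic_deriv_primitive_add:
  assumes "integrable unit_lebesgue f" "integrable unit_lebesgue g"
  shows "dyadic_deriv (primitive (\<lambda>x. f x + g x)) k x
      = dyadic_deriv (primitive f) k x + dyadic_deriv (primitive g) k x"
  by (simp add: dyadic_deriv_def dyadic_quotient_def primitive_add[OF assms] algebra_simps)

lemma dyadic_deriv_primitive_cmult:
  "dyadic_deriv (primitive (\<lambda>x. c * f x)) k x = c * dyadic_deriv (primitive f) k x"
  by (simp add: dyadic_deriv_def dyadic_quotient_def primitive_cmult algebra_simps)

section \<open>Recovering an integrable function from its dyadic averages\<close>

text \<open>Convergence passes to L1 limits because averaging is additive and, uniformly in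
  \<open>k\<close>, a contraction: the error for \<open>f\<close> is at most that for
  \<open>g\<close> plus twice the distance of \<open>f\<close> and \<open>g\<close>.\<close>

lemma dyadic_deriv_L1_tendsto_closure:
  assumes f: "integrable unit_lebesgue f"
    and approx: "\<And>e. e > 0 \<Longrightarrow> \<exists>g. integrable unit_lebesgue g \<and>
      (\<lambda>k. LINT x|unit_lebesgue. \<bar>dyadic_deriv (primitive g) k x - g x\<bar>) \<longlonglongrightarrow> 0 \<and>
      (LINT x|unit_lebesgue. \<bar>f x - g x\<bar>) < e"
  shows "(\<lambda>k. LINT x|unit_lebesgue. \<bar>dyadic_deriv (primitive f) k x - f x\<bar>) \<longlonglongrightarrow> 0"
proof (rule LIMSEQ_I)
  fix e :: real assume "e > 0"
  then have "e / 3 > 0" by simp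
  then obtain g where g: "integrable unit_lebesgue g"
    and lim: "(\<lambda>k. LINT x|unit_lebesgue. \<bar>dyadic_deriv (primitive g) k x - g x\<bar>) \<longlonglongrightarrow> 0"
    and small: "(LINT x|unit_lebesgue. \<bar>f x - g x\<bar>) < e / 3"
    using approx by blast
  obtain N where N: "\<And>k. k \<ge> N \<Longrightarrow> (LINT x|unit_lebesgue. \<bar>dyadic_deriv (primitive g) k x - g x\<bar>) < e / 3"
    using LIMSEQ_D[OF lim \<open>e / 3 > 0\<close>] by auto
  have "norm ((LINT x|unit_lebesgue. \<bar>dyadic_deriv (primitive f) k x - f x\<bar>) - 0) < e" if "k \<ge> N" for k
  proof -
    let ?h = "\<lambda>x. f x - g x"
    have h: "integrable unit_lebesgue ?h" using f g by simp
    have D: "dyadic_deriv (primitive f) k x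
        = dyadic_deriv (primitive ?h) k x + dyadic_deriv (primitive g) k x" for x
      using dyadic_deriv_primitive_add[OF h g, of k x] by simp
    have "(LINT x|unit_lebesgue. \<bar>dyadic_deriv (primitive f) k x - f x\<bar>)
       \<le> (LINT x|unit_lebesgue. \<bar>dyadic_deriv (primitive ?h) k x\<bar>
            + \<bar>dyadic_deriv (primitive g) k x - g x\<bar> + \<bar>?h x\<bar>)"
      using f g h by (intro integral_mono) (auto simp: D)
    also have "\<dots> = (LINT x|unit_lebesgue. \<bar>dyadic_deriv (primitive ?h) k x\<bar>)
            + (LINT x|unit_lebesgue. \<bar>dyadic_deriv (primitive g) k x - g x\<bar>)
            + (LINT x|unit_lebesgue. \<bar>?h x\<bar>)"
      using f g h by simp
    also have "\<dots> < e"
      using dyadic_deriv_primitive_contraction[OF h, of k] N[OF that] small by linarith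
    finally show ?thesis by simp
  qed
  then show "\<exists>no. \<forall>k\<ge>no. norm ((LINT x|unit_lebesgue. \<bar>dyadic_deriv (primitive f) k x - f x\<bar>) - 0) < e"
    by blast
qed

lemma dyadic_quotient_primitive_eq_1:
  assumes f: "integrable unit_lebesgue f" and "j < 2 ^ k"
    and 1: "\<And>y. real j / 2 ^ k \<le> y \<Longrightarrow> y < real (Suc j) / 2 ^ k \<Longrightarrow> f y = 1"
  shows "dyadic_quotient (primitive f) k j = 1"
proof -
  have "real j / 2 ^ k \<le> real (Suc j) / 2 ^ k" by (simp add: divide_right_mono)
  then have "dyadic_quotient (primitive f) k j
      = 2 ^ k * (LINT y|unit_lebesgue. f y * indicator {real j / 2 ^ k..<real (Suc j) / 2 ^ k} y)"
    unfolding dyadic_quotient_def by (simp only: primitive_diff[OF f])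
  also have "(LINT y|unit_lebesgue. f y * indicator {real j / 2 ^ k..<real (Suc j) / 2 ^ k} y)
     = (LINT y|unit_lebesgue. (if dyadic_index k y = j then 1 else 0))"
  proof (rule Bochner_Integration.integral_cong[OF refl])
    fix y :: real assume "y \<in> space unit_lebesgue"
    then have "0 \<le> y" by simp
    then show "f y * indicator {real j / 2 ^ k..<real (Suc j) / 2 ^ k} y = (if dyadic_index k y = j then 1 else 0)"
      using 1[of y] by (auto simp: dyadic_index_eq_iff indicator_def)
  qed
  also have "\<dots> = 1 / 2 ^ k"
    using integral_dyadic_step[of "\<lambda>i. if i = j then 1 else 0" k] assms(2) by simp
  finally show ?thesis by simp
qed

text \<open>Scheffe's argument: \<open>dyadic_deriv\<close> preserves the integral, so it suffices to control the
  positive part of \<open>indicator U x - dyadic_deriv (primitive (indicator U)) k x\<close>, which tends to 0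
  pointwise because \<open>U\<close> is open.\<close>

lemma dyadic_deriv_L1_tendsto_open:
  assumes "open U"
  shows "(\<lambda>k. LINT x|unit_lebesgue. \<bar>dyadic_deriv (primitive (indicator U)) k x - indicator U x\<bar>) \<longlonglongrightarrow> 0"
proof -
  let ?g = "indicator U :: real \<Rightarrow> real"
  let ?D = "dyadic_deriv (primitive ?g)"
  have gm [measurable]: "?g \<in> borel_measurable unit_lebesgue"
    using assms by (intro borel_measurable_unit_lebesgue) simp
  have g: "integrable unit_lebesgue ?g"
    by (rule unit.integrable_const_bound[where B = 1]) (auto simp: indicator_def)
  have Dm [measurable]: "?D k \<in> borel_measurable unit_lebesgue" for k
    using integrable_dyadic_deriv by blast
  have nonneg: "0 \<le> ?D k x" for k x
  proof -
    have "0 \<le> primitive ?g (real (Suc j) / 2 ^ k) - primitive ?g (real j / 2 ^ k)" for j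
      using abs_primitive_diff_le[OF g, of "real j / 2 ^ k" "real (Suc j) / 2 ^ k"]
      by (simp add: divide_right_mono)
    then show ?thesis unfolding dyadic_deriv_def dyadic_quotient_def by simp
  qed
  have lim: "(\<lambda>k. LINT x|unit_lebesgue. max 0 (?g x - ?D k x)) \<longlonglongrightarrow> (LINT x|unit_lebesgue. 0)"
  proof (rule integral_dominated_convergence[where w = "\<lambda>_. 1"])
    show "AE x in unit_lebesgue. (\<lambda>k. max 0 (?g x - ?D k x)) \<longlonglongrightarrow> 0"
      using AE_unit_lebesgue_not_1 AE_space
    proof eventually_elim
      case (elim x)
      then have x: "0 \<le> x" "x < 1" by auto
      show ?case
      proof (cases "x \<in> U")
        case True
        then obtain \<delta> where \<delta>: "\<delta> > 0" "ball x \<delta> \<subseteq> U"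
          using assms openE by blast
        obtain N where N: "(1 / 2) ^ N < \<delta>"
          using real_arch_pow_inv[OF \<delta>(1), of "1/2"] by auto
        \<comment> \<open>Once \<open>1 / 2 ^ k\<close> is below \<open>\<delta>\<close>, the whole
          dyadic interval around \<open>x\<close> lies in \<open>U\<close> and the average is
          exactly 1.\<close>
        have "max 0 (?g x - ?D k x) = 0" if "k \<ge> N" for k
        proof -
          have "1 / 2 ^ k \<le> (1 / 2 ^ N :: real)"
            using that by (intro divide_left_mono power_increasing) auto
          then have small: "1 / 2 ^ k < \<delta>" using N by (simp add: power_one_over)
          have "dyadic_quotient (primitive ?g) k (dyadic_index k x) = 1"
          proof (rule dyadic_quotient_primitive_eq_1[OF g dyadic_index_less[OF x]])
            fix y assume y: "real (dyadic_index k x) / 2 ^ k \<le> y" "y < real (Suc (dyadic_index k x)) / 2 ^ k"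
            have "real (dyadic_index k x) / 2 ^ k \<le> x" "x < real (Suc (dyadic_index k x)) / 2 ^ k"
              using dyadic_index_eq_iff[OF x(1), of k "dyadic_index k x"] by auto
            moreover have "real (Suc (dyadic_index k x)) / 2 ^ k = real (dyadic_index k x) / 2 ^ k + 1 / 2 ^ k"
              by (simp add: add_divide_distrib)
            ultimately have "\<bar>x - y\<bar> < 1 / 2 ^ k" using y by linarith
            then have "y \<in> ball x \<delta>" using small by (simp add: dist_real_def)
            then show "?g y = 1" using \<delta>(2) by auto
          qed
          then show ?thesis using True by (simp add: dyadic_deriv_def)
        qed
        then have "\<forall>\<^sub>F k in sequentially. max 0 (?g x - ?D k x) = 0"
          using eventually_sequentially by blast
        then show ?thesis by (rule tendsto_eventually)
      next
        case False
        then show ?thesis using nonneg by (simp add: max_absorb1)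
      qed
    qed
    show "AE x in unit_lebesgue. norm (max 0 (?g x - ?D k x)) \<le> 1" for k
    proof (rule AE_I2)
      fix x show "norm (max 0 (?g x - ?D k x)) \<le> 1"
        using nonneg[of k x] by (auto simp: indicator_def max_def)
    qed
  qed auto
  have eq: "(LINT x|unit_lebesgue. \<bar>?D k x - ?g x\<bar>) = 2 * (LINT x|unit_lebesgue. max 0 (?g x - ?D k x))" for k
  proof -
    have "\<bar>?D k x - ?g x\<bar> = (?D k x - ?g x) + 2 * max 0 (?g x - ?D k x)" for x
      by (simp add: max_def)
    moreover have "(LINT x|unit_lebesgue. ?D k x) = (LINT x|unit_lebesgue. ?g x)"
      using sum_dyadic_quotient_primitive[OF g, of k]
      unfolding dyadic_deriv_def integral_dyadic_step by simp
    moreover have "integrable unit_lebesgue (\<lambda>x. max 0 (?g x - ?D k x))"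
      using g by (intro integrable_max) auto
    ultimately show ?thesis using g by simp
  qed
  show ?thesis
    unfolding eq using tendsto_mult_left[OF lim, of 2] by simp
qed

text \<open>Induction over integrable functions. The indicator of a measurable set is an L1 limit of
  indicators of open supersets, by outer regularity; sums use the triangle inequality, and limits
  the closure lemma.\<close>

lemma dyadic_deriv_L1_tendsto:
  assumes "integrable unit_lebesgue f"
  shows "(\<lambda>k. LINT x|unit_lebesgue. \<bar>dyadic_deriv (primitive f) k x - f x\<bar>) \<longlonglongrightarrow> 0"
  using assms
proof (induction rule: integrable_induct)
  case (base A c)
  have A: "A \<subseteq> {0..1}" "A \<in> sets lebesgue"
    using base(1) by (auto simp: sets_restrict_space_iff)
  have intA: "integrable unit_lebesgue (indicator A :: real \<Rightarrow> real)"
    using base by simp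
  have lim: "(\<lambda>k. LINT x|unit_lebesgue. \<bar>dyadic_deriv (primitive (indicator A)) k x - indicator A x\<bar>) \<longlonglongrightarrow> 0"
  proof (rule dyadic_deriv_L1_tendsto_closure[OF intA])
    fix e :: real assume "e > 0"
    obtain U where U: "open U" "A \<subseteq> U" "U - A \<in> lmeasurable" "measure lebesgue (U - A) < e"
      using sets_lebesgue_outer_open[OF A(2) \<open>e > 0\<close>]
      by (metis emeasure_eq_measure2 ennreal_less_iff measure_nonneg)
    have gm: "(indicator U :: real \<Rightarrow> real) \<in> borel_measurable unit_lebesgue"
      using U(1) by (intro borel_measurable_unit_lebesgue) simp
    have "integrable unit_lebesgue (indicator U :: real \<Rightarrow> real)"
      by (rule unit.integrable_const_bound[where B = 1]) (use gm in \<open>auto simp: indicator_def\<close>)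
    moreover have "(LINT x|unit_lebesgue. \<bar>indicator A x - indicator U x\<bar>) < e"
    proof -
      have "(LINT x|unit_lebesgue. \<bar>indicator A x - indicator U x\<bar>)
          = (LINT x|unit_lebesgue. (indicator ((U - A) \<inter> {0..1}) x :: real))"
        using U(2) by (intro Bochner_Integration.integral_cong) (auto simp: indicator_def)
      also have "\<dots> = measure lebesgue ((U - A) \<inter> {0..1})"
        by (simp add: measure_restrict_space)
      also have "\<dots> \<le> measure lebesgue (U - A)"
        using U(3) by (intro measure_mono_fmeasurable) auto
      finally show ?thesis using U(4) by simp
    qed
    ultimately show "\<exists>g. integrable unit_lebesgue g \<and>
        (\<lambda>k. LINT x|unit_lebesgue. \<bar>dyadic_deriv (primitive g) k x - g x\<bar>) \<longlonglongrightarrow> 0 \<and>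
        (LINT x|unit_lebesgue. \<bar>indicator A x - g x\<bar>) < e"
      using dyadic_deriv_L1_tendsto_open[OF U(1)] by blast
  qed
  have eq: "\<bar>dyadic_deriv (primitive (\<lambda>x. c * indicator A x)) k x - c * indicator A x\<bar>
      = \<bar>c\<bar> * \<bar>dyadic_deriv (primitive (indicator A)) k x - indicator A x\<bar>" for k x
    unfolding dyadic_deriv_primitive_cmult right_diff_distrib[symmetric] abs_mult by simp
  have "(\<lambda>k. LINT x|unit_lebesgue. \<bar>dyadic_deriv (primitive (\<lambda>x. c * indicator A x)) k x - c * indicator A x\<bar>) \<longlonglongrightarrow> 0"
    unfolding eq using tendsto_mult_left[OF lim, of "\<bar>c\<bar>"] by simp
  then show ?case by (simp add: mult.commute)
next
  case (add f g)
  have bound: "(LINT x|unit_lebesgue. \<bar>dyadic_deriv (primitive (\<lambda>x. f x + g x)) k x - (f x + g x)\<bar>)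
     \<le> (LINT x|unit_lebesgue. \<bar>dyadic_deriv (primitive f) k x - f x\<bar>)
      + (LINT x|unit_lebesgue. \<bar>dyadic_deriv (primitive g) k x - g x\<bar>)" for k
  proof -
    have "(LINT x|unit_lebesgue. \<bar>dyadic_deriv (primitive (\<lambda>x. f x + g x)) k x - (f x + g x)\<bar>)
      \<le> (LINT x|unit_lebesgue. \<bar>dyadic_deriv (primitive f) k x - f x\<bar> + \<bar>dyadic_deriv (primitive g) k x - g x\<bar>)"
      using add.hyps by (intro integral_mono) (auto simp: dyadic_deriv_primitive_add[OF add.hyps])
    then show ?thesis using add.hyps by simp
  qed
  show ?case
    by (rule tendsto_sandwich[OF _ _ tendsto_const tendsto_add_zero[OF add.IH]])
       (auto intro!: always_eventually bound)
next
  case (lim f s)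
  show ?case
  proof (rule dyadic_deriv_L1_tendsto_closure[OF lim.hyps(4)])
    fix e :: real assume "e > 0"
    have "(\<lambda>i. LINT x|unit_lebesgue. \<bar>f x - s i x\<bar>) \<longlonglongrightarrow> (LINT x|unit_lebesgue. 0)"
    \<comment> \<open>The induction rule supplies approximants bounded by twice
      \<open>\<bar>f x\<bar>\<close>, hence the factor 3.\<close>
    proof (rule integral_dominated_convergence[where w = "\<lambda>x. 3 * \<bar>f x\<bar>"])
      show "AE x in unit_lebesgue. (\<lambda>i. \<bar>f x - s i x\<bar>) \<longlonglongrightarrow> 0"
      proof (rule AE_I2)
        fix x assume "x \<in> space unit_lebesgue"
        from tendsto_diff[OF tendsto_const[of "f x"] lim.hyps(2)[OF this]]
        show "(\<lambda>i. \<bar>f x - s i x\<bar>) \<longlonglongrightarrow> 0" by (intro tendsto_rabs_zero) simp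
      qed
      show "AE x in unit_lebesgue. norm \<bar>f x - s i x\<bar> \<le> 3 * \<bar>f x\<bar>" for i
      proof (rule AE_I2)
        fix x assume "x \<in> space unit_lebesgue"
        from lim.hyps(3)[OF this, of i] show "norm \<bar>f x - s i x\<bar> \<le> 3 * \<bar>f x\<bar>" by simp
      qed
    qed (use lim.hyps(1,4) in auto)
    from LIMSEQ_D[OF this \<open>e > 0\<close>] obtain i where "(LINT x|unit_lebesgue. \<bar>f x - s i x\<bar>) < e" by auto
    with lim.hyps(1) lim.IH show "\<exists>g. integrable unit_lebesgue g \<and>
        (\<lambda>k. LINT x|unit_lebesgue. \<bar>dyadic_deriv (primitive g) k x - g x\<bar>) \<longlonglongrightarrow> 0 \<and>
        (LINT x|unit_lebesgue. \<bar>f x - g x\<bar>) < e" by blast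
  qed
qed

section \<open>The embedding and the projection\<close>

lemma ces_avg_le_norm: "a \<in> ces_inf \<Longrightarrow> ces_avg a n \<le> ces_norm a"
  unfolding ces_inf_def ces_norm_def by (auto intro: cSUP_upper)

lemma ces_norm_nonneg: "a \<in> ces_inf \<Longrightarrow> 0 \<le> ces_norm a"
  by (rule order_trans[OF _ ces_avg_le_norm[of a 0]]) (auto simp: ces_avg_def)

text \<open>The block ends an initial segment less than twice as long as itself, so the average over
  that segment controls the block up to a factor 2. The \<open>- 1\<close> turns positions counted
  from 1 into indices counted from 0.\<close>

lemma ces_block_le:
  assumes "a \<in> ces_inf"
  shows "(\<Sum>j<2 ^ n. \<bar>a (2 ^ n + j - 1)\<bar>) \<le> 2 ^ n * (2 * ces_norm a)"
proof -
  \<comment> \<open>The last index of block \<open>n\<close>; the segment up to it has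
    \<open>2 * 2 ^ n - 1\<close> entries.\<close>
  define N :: nat where "N = 2 * 2 ^ n - 2"
  have p: "(1::nat) \<le> 2 ^ n" by simp
  then have N: "Suc N \<le> 2 * 2 ^ n" unfolding N_def by linarith
  have inj: "inj_on (\<lambda>j::nat. 2 ^ n + j - 1) {..<2 ^ n}"
    using p by (auto simp: inj_on_def)
  have "(\<Sum>j<2 ^ n. \<bar>a (2 ^ n + j - 1)\<bar>) = (\<Sum>i\<in>(\<lambda>j. 2 ^ n + j - 1) ` {..<2 ^ n}. \<bar>a i\<bar>)"
    by (subst sum.reindex[OF inj]) (simp add: o_def)
  also have "\<dots> \<le> (\<Sum>i\<le>N. \<bar>a i\<bar>)"
    by (rule sum_mono2) (auto simp: N_def)
  also have "\<dots> = real (Suc N) * ces_avg a N" by (simp add: ces_avg_def)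
  also have "\<dots> \<le> real (Suc N) * ces_norm a"
    by (intro mult_left_mono ces_avg_le_norm assms) simp
  also have "\<dots> \<le> real (2 * 2 ^ n) * ces_norm a"
    using N by (intro mult_right_mono ces_norm_nonneg assms) (simp only: of_nat_le_iff)
  finally show ?thesis by simp
qed

lemma sum_lessThan_add:
  fixes f :: "nat \<Rightarrow> real"
  shows "(\<Sum>i<m + n. f i) = (\<Sum>i<m. f i) + (\<Sum>j<n. f (m + j))"
  by (induction n) (simp_all add: add.assoc)

text \<open>Converse of \<open>ces_block_le\<close>: an initial segment of length
  \<open>Suc N\<close> is covered by the blocks up to the one containing its end, and these have
  fewer than \<open>2 * Suc N\<close> entries together.\<close>

lemma ces_infI_blocks:
  assumes block: "\<And>k. (\<Sum>j<2 ^ k. \<bar>a (2 ^ k + j - 1)\<bar>) \<le> 2 ^ k * B"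
  shows "a \<in> ces_inf" and "ces_norm a \<le> 2 * B"
proof -
  have B: "0 \<le> B" using block[of 0] by (simp add: order_trans[OF abs_ge_zero])
  have init: "(\<Sum>i<2 ^ k - 1. \<bar>a i\<bar>) \<le> (2 ^ k - 1) * B" for k
  proof (induction k)
    case 0
    then show ?case by simp
  next
    case (Suc k)
    have "(\<Sum>i<2 ^ Suc k - 1. \<bar>a i\<bar>) = (\<Sum>i<(2 ^ k - 1) + 2 ^ k. \<bar>a i\<bar>)"
      by (rule arg_cong[where f = "\<lambda>n. \<Sum>i<n. \<bar>a i\<bar>"]) simp
    also have "\<dots> = (\<Sum>i<2 ^ k - 1. \<bar>a i\<bar>) + (\<Sum>j<2 ^ k. \<bar>a (2 ^ k - 1 + j)\<bar>)"
      by (rule sum_lessThan_add)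
    also have "(\<Sum>j<2 ^ k. \<bar>a (2 ^ k - 1 + j)\<bar>) = (\<Sum>j<2 ^ k. \<bar>a (2 ^ k + j - 1)\<bar>)" by simp
    finally show ?case using Suc block[of k] by (simp add: algebra_simps)
  qed
  have le: "ces_avg a N \<le> 2 * B" for N
  proof -
    define k where "k = Suc (floor_log (Suc N))"
    have "Suc N < 2 ^ k" using floor_log_exp2_gt[of "Suc N"] by (simp add: k_def)
    have "2 ^ floor_log (Suc N) \<le> Suc N" by (rule floor_log_exp2_le) simp
    then have "2 ^ k \<le> 2 * Suc N" by (simp add: k_def)
    then have k2: "(2::real) ^ k \<le> 2 * real (Suc N)"
      by (metis of_nat_le_iff of_nat_mult of_nat_numeral of_nat_power)
    have "(\<Sum>i\<le>N. \<bar>a i\<bar>) \<le> (\<Sum>i<2 ^ k - 1. \<bar>a i\<bar>)"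
      using \<open>Suc N < 2 ^ k\<close> by (intro sum_mono2) auto
    also have "\<dots> \<le> (2 ^ k - 1) * B" by (rule init)
    also have "\<dots> \<le> 2 * real (Suc N) * B"
      using k2 by (intro mult_right_mono B) linarith
    finally show ?thesis by (simp add: ces_avg_def divide_le_eq mult.commute mult.left_commute)
  qed
  then show "a \<in> ces_inf" by (auto simp: ces_inf_def bdd_above_def)
  show "ces_norm a \<le> 2 * B" unfolding ces_norm_def by (rule cSUP_least) (auto simp: le)
qed

lemma ces_inf_add:
  assumes "a \<in> ces_inf" "b \<in> ces_inf"
  shows "(\<lambda>n. a n + b n) \<in> ces_inf"
proof -
  have "ces_avg (\<lambda>n. a n + b n) n \<le> ces_norm a + ces_norm b" for n
  proof -
    have "ces_avg (\<lambda>n. a n + b n) n \<le> ces_avg a n + ces_avg b n"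
      unfolding ces_avg_def add_divide_distrib[symmetric] sum.distrib[symmetric]
      by (intro divide_right_mono sum_mono abs_triangle_ineq) simp
    then show ?thesis using assms[THEN ces_avg_le_norm, of n] by linarith
  qed
  then show ?thesis by (auto simp: ces_inf_def bdd_above_def)
qed

lemma ces_inf_cmult:
  assumes "a \<in> ces_inf"
  shows "(\<lambda>n. c * a n) \<in> ces_inf"
proof -
  have "ces_avg (\<lambda>n. c * a n) n \<le> \<bar>c\<bar> * ces_norm a" for n
  proof -
    have "ces_avg (\<lambda>n. c * a n) n = \<bar>c\<bar> * ces_avg a n"
      by (simp add: ces_avg_def abs_mult sum_distrib_left)
    then show ?thesis using ces_avg_le_norm[OF assms, of n] by (simp add: mult_left_mono)
  qed
  then show ?thesis by (auto simp: ces_inf_def bdd_above_def)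
qed

section \<open>The embedding\<close>

text \<open>Block \<open>k\<close> of the sequence, the positions \<open>n\<close> with \<open>n + 1 = 2 ^ k + j\<close> and \<open>j < 2 ^ k\<close>, holds
  the difference quotients over the \<open>2 ^ k\<close> dyadic intervals of level \<open>k\<close>.\<close>

definition dyadic_seq :: "(real \<Rightarrow> real) \<Rightarrow> nat \<Rightarrow> real" where
  "dyadic_seq F n = dyadic_quotient F (floor_log (Suc n)) (Suc n - 2 ^ floor_log (Suc n))"

lemma dyadic_seq_block:
  assumes "j < 2 ^ k"
  shows "dyadic_seq F (2 ^ k + j - 1) = dyadic_quotient F k j"
proof -
  have "floor_log (2 ^ k + j) = k"
    using assms by (intro floor_log_eqI) auto
  moreover have "Suc (2 ^ k + j - 1) = 2 ^ k + j" by simp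
  ultimately show ?thesis unfolding dyadic_seq_def by simp
qed

lemma dyadic_seq_primitive_ces:
  assumes "integrable unit_lebesgue f"
  shows "dyadic_seq (primitive f) \<in> ces_inf"
    and "ces_norm (dyadic_seq (primitive f)) \<le> 2 * (LINT x|unit_lebesgue. \<bar>f x\<bar>)"
proof -
  have "(\<Sum>j<2 ^ k. \<bar>dyadic_seq (primitive f) (2 ^ k + j - 1)\<bar>) \<le> 2 ^ k * (LINT x|unit_lebesgue. \<bar>f x\<bar>)" for k
    using sum_abs_dyadic_quotient_primitive[OF assms, of k]
    by (simp add: dyadic_seq_block del: One_nat_def)
  then show "dyadic_seq (primitive f) \<in> ces_inf"
    "ces_norm (dyadic_seq (primitive f)) \<le> 2 * (LINT x|unit_lebesgue. \<bar>f x\<bar>)"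
    by (rule ces_infI_blocks)+
qed

text \<open>The average of absolute values over block \<open>k\<close> is the L1 norm of the
  level-\<open>k\<close> dyadic derivative, which approaches that of \<open>f\<close>. The bound
  from \<open>ces_block_le\<close> on every block therefore survives as \<open>k\<close>
  grows.\<close>

lemma L1_le_ces_norm_dyadic_seq:
  assumes f: "integrable unit_lebesgue f"
  shows "(LINT x|unit_lebesgue. \<bar>f x\<bar>) \<le> 2 * ces_norm (dyadic_seq (primitive f))"
proof -
  let ?N = "2 * ces_norm (dyadic_seq (primitive f))"
  let ?e = "\<lambda>k. LINT x|unit_lebesgue. \<bar>dyadic_deriv (primitive f) k x - f x\<bar>"
  have "(LINT x|unit_lebesgue. \<bar>f x\<bar>) \<le> ?N + ?e k" for k
  proof -
    have "(LINT x|unit_lebesgue. \<bar>f x\<bar>)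
       \<le> (LINT x|unit_lebesgue. \<bar>dyadic_deriv (primitive f) k x\<bar> + \<bar>dyadic_deriv (primitive f) k x - f x\<bar>)"
      using f by (intro integral_mono) auto
    also have "\<dots> = (LINT x|unit_lebesgue. \<bar>dyadic_deriv (primitive f) k x\<bar>) + ?e k"
      using f by simp
    also have "(LINT x|unit_lebesgue. \<bar>dyadic_deriv (primitive f) k x\<bar>) \<le> ?N"
      using ces_block_le[OF dyadic_seq_primitive_ces(1)[OF f], of k]
      by (simp add: integral_abs_dyadic_deriv dyadic_seq_block divide_le_eq mult_ac del: One_nat_def)
    finally show ?thesis by simp
  qed
  moreover have "(\<lambda>k. ?N + ?e k) \<longlonglongrightarrow> ?N + 0"
    by (intro tendsto_intros dyadic_deriv_L1_tendsto f)
  ultimately show ?thesis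
    by (intro LIMSEQ_le_const[where X = "\<lambda>k. ?N + ?e k"]) auto
qed

section \<open>Limit charges along an ultrafilter\<close>

text \<open>One free ultrafilter is fixed for all sequences: limits along a common filter are
  linear, whereas convergent subsequences chosen for each sequence would not be.\<close>

definition ultra :: "nat filter" where
  "ultra = (SOME U. U \<le> sequentially \<and> U \<noteq> bot \<and> (\<forall>G. G \<le> U \<longrightarrow> G \<noteq> bot \<longrightarrow> G = U))"

lemma ultra: "ultra \<le> sequentially" "ultra \<noteq> bot" "G \<le> ultra \<Longrightarrow> G \<noteq> bot \<Longrightarrow> G = ultra"
proof -
  have "\<exists>U. U \<le> sequentially \<and> U \<noteq> bot \<and> (\<forall>G. G \<le> U \<longrightarrow> G \<noteq> bot \<longrightarrow> G = (U :: nat filter))"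
    by (rule ultrafilter_below[OF sequentially_bot]) blast
  from someI_ex[OF this]
  show "ultra \<le> sequentially" "ultra \<noteq> bot" "G \<le> ultra \<Longrightarrow> G \<noteq> bot \<Longrightarrow> G = ultra"
    unfolding ultra_def[symmetric] by blast+
qed

text \<open>The minimum truncates at \<open>q = 1\<close>: past it the sum would run into block \<open>n + 1\<close>.\<close>

definition block_mass :: "(nat \<Rightarrow> real) \<Rightarrow> nat \<Rightarrow> real \<Rightarrow> real" where
  "block_mass a n q = (\<Sum>j<min (2 ^ n) (dyadic_index n q). a (2 ^ n + j - 1)) / 2 ^ n"

text \<open>The limit is taken separately at each \<open>q\<close>. The increments over half-open
  intervals form a finitely additive charge, possibly with a singular part, which the density later
  discards.\<close>

definition charge :: "(nat \<Rightarrow> real) \<Rightarrow> real \<Rightarrow> real" where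
  "charge a q = Lim ultra (\<lambda>n. block_mass a n q)"

lemma abs_block_mass_diff_le:
  assumes "p \<le> q"
  shows "\<bar>block_mass a n q - block_mass a n p\<bar> \<le> block_mass (\<lambda>i. \<bar>a i\<bar>) n q - block_mass (\<lambda>i. \<bar>a i\<bar>) n p"
proof -
  let ?m = "\<lambda>q. min (2 ^ n) (dyadic_index n q)"
  have m: "?m p \<le> ?m q"
    unfolding dyadic_index_def using assms
    by (intro min.mono nat_mono floor_mono mult_left_mono) auto
  have diff: "block_mass b n q - block_mass b n p = (\<Sum>j=?m p..<?m q. b (2 ^ n + j - 1)) / 2 ^ n" for b
    using sum_diff_nat_ivl[OF le0 m, of "\<lambda>j. b (2 ^ n + j - 1)"]
    by (simp add: block_mass_def diff_divide_distrib[symmetric] atLeast0LessThan)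
  show ?thesis unfolding diff abs_divide by (simp add: divide_right_mono sum_abs)
qed

lemma block_mass_abs_le:
  assumes "a \<in> ces_inf"
  shows "block_mass (\<lambda>i. \<bar>a i\<bar>) n q \<le> 2 * ces_norm a"
proof -
  have "(\<Sum>j<min (2 ^ n) (dyadic_index n q). \<bar>a (2 ^ n + j - 1)\<bar>) \<le> (\<Sum>j<2 ^ n. \<bar>a (2 ^ n + j - 1)\<bar>)"
    by (rule sum_mono2) auto
  also have "\<dots> \<le> 2 ^ n * (2 * ces_norm a)" by (rule ces_block_le[OF assms])
  finally show ?thesis by (simp add: block_mass_def divide_le_eq mult_ac)
qed

lemma block_mass_0 [simp]: "block_mass a n 0 = 0"
  by (simp add: block_mass_def dyadic_index_def)

lemma block_mass_nonpos:
  assumes "q \<le> 0"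
  shows "block_mass a n q = 0"
proof -
  have "2 ^ n * q \<le> 0" using assms by (simp add: mult_nonneg_nonpos)
  then have "dyadic_index n q = 0" by (simp add: dyadic_index_def)
  then show ?thesis by (simp add: block_mass_def)
qed

lemma abs_block_mass_le:
  assumes "a \<in> ces_inf"
  shows "\<bar>block_mass a n q\<bar> \<le> 2 * ces_norm a"
proof (cases "0 \<le> q")
  case True
  then show ?thesis
    using abs_block_mass_diff_le[of 0 q a n] block_mass_abs_le[OF assms, of n q] by simp
next
  case False
  then show ?thesis using ces_norm_nonneg[OF assms] by (simp add: block_mass_nonpos)
qed

lemma tendsto_charge:
  assumes "a \<in> ces_inf"
  shows "((\<lambda>n. block_mass a n q) \<longlongrightarrow> charge a q) ultra"
proof -
  obtain l where "((\<lambda>n. block_mass a n q) \<longlongrightarrow> l) ultra"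
    using ultrafilter_bounded_tendsto[of ultra "\<lambda>n. block_mass a n q", OF ultra(2) ultra(3)
        abs_block_mass_le[OF assms]] by blast
  then show ?thesis unfolding charge_def using tendsto_Lim[OF ultra(2)] by blast
qed

lemma charge_eqI:
  assumes "((\<lambda>n. block_mass a n q) \<longlongrightarrow> l) ultra"
  shows "charge a q = l"
  unfolding charge_def by (rule tendsto_Lim[OF ultra(2) assms])

lemma charge_add:
  assumes "a \<in> ces_inf" "b \<in> ces_inf"
  shows "charge (\<lambda>n. a n + b n) q = charge a q + charge b q"
proof (rule charge_eqI)
  have "block_mass (\<lambda>n. a n + b n) n q = block_mass a n q + block_mass b n q" for n
    by (simp add: block_mass_def sum.distrib add_divide_distrib)
  then show "((\<lambda>n. block_mass (\<lambda>n. a n + b n) n q) \<longlongrightarrow> charge a q + charge b q) ultra"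
    using tendsto_add[OF tendsto_charge tendsto_charge, OF assms] by simp
qed

lemma charge_cmult:
  assumes "a \<in> ces_inf"
  shows "charge (\<lambda>n. c * a n) q = c * charge a q"
proof (rule charge_eqI)
  have "block_mass (\<lambda>n. c * a n) n q = c * block_mass a n q" for n
    by (simp add: block_mass_def sum_distrib_left)
  then show "((\<lambda>n. block_mass (\<lambda>n. c * a n) n q) \<longlongrightarrow> c * charge a q) ultra"
    using tendsto_mult_left[OF tendsto_charge[OF assms]] by simp
qed

text \<open>The L1 bound for the martingale. For fixed \<open>k\<close> the sum is finite, so it
  suffices to bound it for each \<open>block_mass a n\<close>; there the quotients of
  \<open>\<bar>a\<bar>\<close> dominate and telescope to the mass of block \<open>n\<close>.\<close>

lemma sum_abs_dyadic_quotient_charge: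
  assumes "a \<in> ces_inf"
  shows "(\<Sum>j<2 ^ k. \<bar>dyadic_quotient (charge a) k j\<bar>) \<le> 2 ^ k * (2 * ces_norm a)"
proof (rule tendsto_upperbound[OF _ _ ultra(2)])
  show "((\<lambda>n. \<Sum>j<2 ^ k. \<bar>dyadic_quotient (block_mass a n) k j\<bar>)
     \<longlongrightarrow> (\<Sum>j<2 ^ k. \<bar>dyadic_quotient (charge a) k j\<bar>)) ultra"
    unfolding dyadic_quotient_def by (intro tendsto_intros tendsto_charge assms)
  have "(\<Sum>j<2 ^ k. \<bar>dyadic_quotient (block_mass a n) k j\<bar>) \<le> 2 ^ k * (2 * ces_norm a)" for n
  proof -
    have "(\<Sum>j<2 ^ k. \<bar>dyadic_quotient (block_mass a n) k j\<bar>)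
       \<le> (\<Sum>j<2 ^ k. dyadic_quotient (block_mass (\<lambda>i. \<bar>a i\<bar>) n) k j)"
      unfolding dyadic_quotient_def abs_mult
      by (intro sum_mono) (simp add: abs_block_mass_diff_le divide_right_mono)
    also have "\<dots> = 2 ^ k * block_mass (\<lambda>i. \<bar>a i\<bar>) n 1"
      using sum_dyadic_quotient[of 0 "2 ^ k" "block_mass (\<lambda>i. \<bar>a i\<bar>) n" k]
      by (simp add: atLeast0LessThan)
    also have "\<dots> \<le> 2 ^ k * (2 * ces_norm a)"
      using block_mass_abs_le[OF assms] by simp
    finally show ?thesis .
  qed
  then show "\<forall>\<^sub>F n in ultra. (\<Sum>j<2 ^ k. \<bar>dyadic_quotient (block_mass a n) k j\<bar>) \<le> 2 ^ k * (2 * ces_norm a)"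
    by simp
qed

text \<open>From \<open>n = k\<close> on, the point is a grid point of level \<open>n\<close> and
  the entries of the block telescope to \<open>F\<close> exactly, so the limit is that of an
  eventually constant sequence. Constancy of \<open>F\<close> past 1 matches the truncation in
  \<open>block_mass\<close>.\<close>

lemma charge_dyadic_seq:
  assumes "F 0 = 0" and "\<And>q. 1 \<le> q \<Longrightarrow> F q = F 1"
  shows "charge (dyadic_seq F) (real i / 2 ^ k) = F (real i / 2 ^ k)"
proof (rule charge_eqI)
  have "block_mass (dyadic_seq F) n (real i / 2 ^ k) = F (real i / 2 ^ k)" if "k \<le> n" for n
  proof -
    let ?q = "real i / 2 ^ k"
    define m where "m = min (2 ^ n) (dyadic_index n ?q)"
    have pow: "(2::real) ^ n = 2 ^ k * 2 ^ (n - k)" using that by (simp add: power_add[symmetric])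
    have "2 ^ n * ?q = real (i * 2 ^ (n - k))" by (simp add: pow)
    then have idx: "dyadic_index n ?q = i * 2 ^ (n - k)"
      unfolding dyadic_index_def by (simp only: floor_of_nat nat_int)
    have "(\<Sum>j<m. dyadic_seq F (2 ^ n + j - 1)) = (\<Sum>j=0..<m. dyadic_quotient F n j)"
      unfolding atLeast0LessThan by (intro sum.cong) (auto simp: m_def dyadic_seq_block simp del: One_nat_def)
    also have "\<dots> = 2 ^ n * F (real m / 2 ^ n)"
      by (simp add: sum_dyadic_quotient assms(1))
    finally have "block_mass (dyadic_seq F) n ?q = F (real m / 2 ^ n)"
      by (simp add: block_mass_def m_def)
    also have "\<dots> = F ?q"
    proof (cases "dyadic_index n ?q \<le> 2 ^ n")
      case True
      then have "real m / 2 ^ n = ?q" by (simp add: m_def idx pow)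
      then show ?thesis by simp
    next
      case False
      then have "real m / 2 ^ n = 1" by (simp add: m_def)
      moreover have "1 \<le> ?q"
      proof -
        have "2 ^ n \<le> i * 2 ^ (n - k)" using False idx by simp
        then have "2 ^ k * 2 ^ (n - k) \<le> i * 2 ^ (n - k)"
          using that by (simp add: power_add[symmetric])
        then have "2 ^ k \<le> i" by simp
        then have "2 ^ k \<le> real i" by (metis of_nat_le_iff of_nat_numeral of_nat_power)
        then show ?thesis by (simp add: divide_simps)
      qed
      ultimately show ?thesis using assms(2)[of ?q] by metis
    qed
    finally show ?thesis .
  qed
  then have "\<forall>\<^sub>F n in sequentially. block_mass (dyadic_seq F) n (real i / 2 ^ k) = F (real i / 2 ^ k)"
    using eventually_sequentially by blast
  then have "\<forall>\<^sub>F n in ultra. block_mass (dyadic_seq F) n (real i / 2 ^ k) = F (real i / 2 ^ k)"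
    using ultra(1) filter_leD by blast
  then show "((\<lambda>n. block_mass (dyadic_seq F) n (real i / 2 ^ k)) \<longlongrightarrow> F (real i / 2 ^ k)) ultra"
    by (rule tendsto_eventually)
qed

lemma dyadic_deriv_charge_dyadic_seq:
  assumes "integrable unit_lebesgue f"
  shows "dyadic_deriv (charge (dyadic_seq (primitive f))) = dyadic_deriv (primitive f)"
proof -
  have "charge (dyadic_seq (primitive f)) (real i / 2 ^ k) = primitive f (real i / 2 ^ k)" for i k
    by (rule charge_dyadic_seq) (simp_all add: primitive_ge_1[OF assms])
  then show ?thesis
    unfolding dyadic_deriv_def[abs_def] dyadic_quotient_def by (simp del: of_nat_Suc)
qed

section \<open>The absolutely continuous part\<close>

text \<open>A limit in measure is determined only up to a null set, so \<open>SOME\<close> picks a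
  representative and all identities for it hold almost everywhere only.\<close>

definition charge_density :: "(nat \<Rightarrow> real) \<Rightarrow> real \<Rightarrow> real" where
  "charge_density a = (SOME g. integrable unit_lebesgue g \<and>
     (LINT x|unit_lebesgue. \<bar>g x\<bar>) \<le> 2 * ces_norm a \<and>
     squash_tendsto unit_lebesgue (dyadic_deriv (charge a)) g)"

lemma charge_density:
  assumes "a \<in> ces_inf"
  shows "integrable unit_lebesgue (charge_density a)"
    and "(LINT x|unit_lebesgue. \<bar>charge_density a x\<bar>) \<le> 2 * ces_norm a"
    and "squash_tendsto unit_lebesgue (dyadic_deriv (charge a)) (charge_density a)"
proof -
  have "\<exists>g. integrable unit_lebesgue g \<and> (LINT x|unit_lebesgue. \<bar>g x\<bar>) \<le> 2 * ces_norm a \<and>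
     squash_tendsto unit_lebesgue (dyadic_deriv (charge a)) g"
  proof (rule unit.L1_bounded_martingale_converges)
    show "(LINT x|unit_lebesgue. \<bar>dyadic_deriv (charge a) k x\<bar>) \<le> 2 * ces_norm a" for k
      using sum_abs_dyadic_quotient_charge[OF assms, of k]
      by (simp add: integral_abs_dyadic_deriv divide_le_eq mult_ac)
  qed (simp_all add: dyadic_deriv_martingale)
  from someI_ex[OF this]
  show "integrable unit_lebesgue (charge_density a)"
    and "(LINT x|unit_lebesgue. \<bar>charge_density a x\<bar>) \<le> 2 * ces_norm a"
    and "squash_tendsto unit_lebesgue (dyadic_deriv (charge a)) (charge_density a)"
    unfolding charge_density_def[symmetric] by blast+
qed

text \<open>\<open>charge\<close> and its dyadic derivatives are exactly linear on
  \<open>ces_inf\<close>; limits in measure inherit this almost everywhere.\<close>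

lemma charge_density_linear:
  assumes "a \<in> ces_inf" "b \<in> ces_inf"
  shows "AE x in unit_lebesgue. charge_density (\<lambda>n. \<alpha> * a n + \<beta> * b n) x
    = \<alpha> * charge_density a x + \<beta> * charge_density b x"
proof (rule unit.squash_tendsto_linear)
  have c: "(\<lambda>n. \<alpha> * a n) \<in> ces_inf" "(\<lambda>n. \<beta> * b n) \<in> ces_inf"
    using assms by (auto intro: ces_inf_cmult)
  have ab: "(\<lambda>n. \<alpha> * a n + \<beta> * b n) \<in> ces_inf" by (rule ces_inf_add[OF c])
  show "squash_tendsto unit_lebesgue (dyadic_deriv (charge a)) (charge_density a)"
    "squash_tendsto unit_lebesgue (dyadic_deriv (charge b)) (charge_density b)"
    "squash_tendsto unit_lebesgue (dyadic_deriv (charge (\<lambda>n. \<alpha> * a n + \<beta> * b n)))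
       (charge_density (\<lambda>n. \<alpha> * a n + \<beta> * b n))"
    by (rule charge_density(3)[OF assms(1)] charge_density(3)[OF assms(2)] charge_density(3)[OF ab])+
  show "charge_density a \<in> borel_measurable unit_lebesgue"
    "charge_density b \<in> borel_measurable unit_lebesgue"
    "charge_density (\<lambda>n. \<alpha> * a n + \<beta> * b n) \<in> borel_measurable unit_lebesgue"
    using charge_density(1)[OF assms(1)] charge_density(1)[OF assms(2)] charge_density(1)[OF ab] by auto
  show "dyadic_deriv (charge (\<lambda>n. \<alpha> * a n + \<beta> * b n)) k x
      = \<alpha> * dyadic_deriv (charge a) k x + \<beta> * dyadic_deriv (charge b) k x" for k x
    unfolding dyadic_deriv_def dyadic_quotient_def
      charge_add[OF c] charge_cmult[OF assms(1)] charge_cmult[OF assms(2)]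
    by (simp add: algebra_simps)
qed (use integrable_dyadic_deriv in \<open>blast+\<close>)

text \<open>The density inverts the embedding: the charge of the embedded \<open>f\<close> has the
  same dyadic derivatives as the primitive of \<open>f\<close>, and these converge to
  \<open>f\<close> in L1, hence in measure.\<close>

lemma charge_density_dyadic_seq:
  assumes "integrable unit_lebesgue f"
  shows "AE x in unit_lebesgue. charge_density (dyadic_seq (primitive f)) x = f x"
proof (rule unit.squash_tendsto_unique)
  have ces: "dyadic_seq (primitive f) \<in> ces_inf" by (rule dyadic_seq_primitive_ces(1)[OF assms])
  show "squash_tendsto unit_lebesgue (dyadic_deriv (primitive f)) (charge_density (dyadic_seq (primitive f)))"
    using charge_density(3)[OF ces] by (simp only: dyadic_deriv_charge_dyadic_seq[OF assms])
  show "squash_tendsto unit_lebesgue (dyadic_deriv (primitive f)) f"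
    by (rule unit.squash_tendsto_L1) (simp_all add: assms dyadic_deriv_L1_tendsto)
  show "charge_density (dyadic_seq (primitive f)) \<in> borel_measurable unit_lebesgue"
    using charge_density(1)[OF ces] by blast
qed (use assms integrable_dyadic_deriv in \<open>blast+\<close>)

text \<open>The embedding is well defined on classes modulo null sets. This turns the almost
  everywhere identities for \<open>charge_density\<close> into equalities of sequences.\<close>

lemma dyadic_seq_cong_AE:
  assumes "integrable unit_lebesgue f" "integrable unit_lebesgue g" "AE x in unit_lebesgue. f x = g x"
  shows "dyadic_seq (primitive f) = dyadic_seq (primitive g)"
  using primitive_cong_AE[OF assms] by simp

lemma dyadic_seq_primitive_linear:
  assumes "integrable unit_lebesgue f" "integrable unit_lebesgue g"
  shows "dyadic_seq (primitive (\<lambda>x. \<alpha> * f x + \<beta> * g x))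
    = (\<lambda>n. \<alpha> * dyadic_seq (primitive f) n + \<beta> * dyadic_seq (primitive g) n)"
proof -
  have "primitive (\<lambda>x. \<alpha> * f x + \<beta> * g x) q = \<alpha> * primitive f q + \<beta> * primitive g q" for q
    using assms by (subst primitive_add) (auto simp: primitive_cmult)
  then show ?thesis by (simp add: fun_eq_iff dyadic_seq_def dyadic_quotient_def algebra_simps)
qed

section \<open>Assembling the embedding and the projection\<close>

lemma L1_01_iff: "f \<in> L1_01 \<longleftrightarrow> integrable unit_lebesgue f"
  by (simp add: L1_01_def set_integrable_def integrable_restrict_space)

lemma L1_norm_eq: "L1_norm f = (LINT x|unit_lebesgue. \<bar>f x\<bar>)"
  by (simp add: L1_norm_def set_lebesgue_integral_def integral_restrict_space)

theorem theorem3: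
  shows "\<exists>(T :: (real \<Rightarrow> real) \<Rightarrow> (nat \<Rightarrow> real)) (P :: (nat \<Rightarrow> real) \<Rightarrow> (nat \<Rightarrow> real)) c C K.
     \<comment> \<open>T is a linear isomorphic embedding of L_1[0,1] into ces_infinity\<close>
     (\<forall>f\<in>L1_01. T f \<in> ces_inf) \<and>
     (\<forall>f\<in>L1_01. \<forall>g\<in>L1_01. T (\<lambda>x. f x + g x) = (\<lambda>n. T f n + T g n)) \<and>
     (\<forall>f\<in>L1_01. \<forall>r::real. T (\<lambda>x. r * f x) = (\<lambda>n. r * T f n)) \<and>
     0 < c \<and> 0 < C \<and>
     (\<forall>f\<in>L1_01. c * L1_norm f \<le> ces_norm (T f) \<and> ces_norm (T f) \<le> C * L1_norm f) \<and>
     \<comment> \<open>P is a bounded linear projection of ces_infinity onto the image T(L_1[0,1])\<close>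
     (\<forall>a\<in>ces_inf. P a \<in> ces_inf) \<and>
     (\<forall>a\<in>ces_inf. \<forall>b\<in>ces_inf. P (\<lambda>n. a n + b n) = (\<lambda>n. P a n + P b n)) \<and>
     (\<forall>a\<in>ces_inf. \<forall>r::real. P (\<lambda>n. r * a n) = (\<lambda>n. r * P a n)) \<and>
     (\<forall>a\<in>ces_inf. ces_norm (P a) \<le> K * ces_norm a) \<and>
     (\<forall>a\<in>ces_inf. P (P a) = P a) \<and>
     P ` ces_inf = T ` L1_01"
proof -
  define T where "T f = dyadic_seq (primitive f)" for f
  define P where "P a = T (charge_density a)" for a
  have T_ces: "T f \<in> ces_inf" if "f \<in> L1_01" for f
    using that dyadic_seq_primitive_ces(1) by (simp add: T_def L1_01_iff)
  have T_lin: "T (\<lambda>x. \<alpha> * f x + \<beta> * g x) = (\<lambda>n. \<alpha> * T f n + \<beta> * T g n)"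
    if "f \<in> L1_01" "g \<in> L1_01" for f g \<alpha> \<beta>
    using that dyadic_seq_primitive_linear by (simp add: T_def L1_01_iff)
  have T_le: "ces_norm (T f) \<le> 2 * L1_norm f" if "f \<in> L1_01" for f
    using that dyadic_seq_primitive_ces(2) by (simp add: T_def L1_01_iff L1_norm_eq)
  have T_ge: "1 / 2 * L1_norm f \<le> ces_norm (T f)" if "f \<in> L1_01" for f
    using that L1_le_ces_norm_dyadic_seq[of f] by (simp add: T_def L1_01_iff L1_norm_eq)
  have dens: "charge_density a \<in> L1_01" if "a \<in> ces_inf" for a
    using that by (simp add: L1_01_iff charge_density(1))
  have P_lin: "P (\<lambda>n. \<alpha> * a n + \<beta> * b n) = (\<lambda>n. \<alpha> * P a n + \<beta> * P b n)"
    if ab: "a \<in> ces_inf" "b \<in> ces_inf" for a b \<alpha> \<beta>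
  proof -
    have c: "(\<lambda>n. \<alpha> * a n + \<beta> * b n) \<in> ces_inf"
      using ab by (intro ces_inf_add ces_inf_cmult)
    have "P (\<lambda>n. \<alpha> * a n + \<beta> * b n) = T (\<lambda>x. \<alpha> * charge_density a x + \<beta> * charge_density b x)"
      unfolding P_def T_def
      by (rule dyadic_seq_cong_AE[OF _ _ charge_density_linear[OF ab]])
         (use ab c charge_density(1) in auto)
    also have "\<dots> = (\<lambda>n. \<alpha> * P a n + \<beta> * P b n)"
      unfolding P_def by (rule T_lin) (use ab dens in auto)
    finally show ?thesis .
  qed
  have PT: "P (T f) = T f" if "f \<in> L1_01" for f
    unfolding P_def T_def
    by (rule dyadic_seq_cong_AE)
       (use that T_ces[OF that] in \<open>auto simp: L1_01_iff T_def charge_density(1) charge_density_dyadic_seq\<close>)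
  have P_norm: "ces_norm (P a) \<le> 4 * ces_norm a" if "a \<in> ces_inf" for a
    using T_le[OF dens[OF that]] charge_density(2)[OF that] by (simp add: P_def L1_norm_eq)
  show ?thesis
  \<comment> \<open>Passing between block averages and Cesaro averages costs a factor 2 in either
    direction, giving \<open>1 / 2\<close> and \<open>2\<close>; the projection combines the bound 2
    for the density with the bound 2 for \<open>T\<close>.\<close>
  proof (rule exI[of _ T], rule exI[of _ P], rule exI[of _ "1 / 2"], rule exI[of _ 2], rule exI[of _ 4],
      intro conjI ballI allI)
    show "P ` ces_inf = T ` L1_01"
    proof
      show "P ` ces_inf \<subseteq> T ` L1_01" using dens by (auto simp: P_def)
      show "T ` L1_01 \<subseteq> P ` ces_inf"
      proof
        fix b assume "b \<in> T ` L1_01"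
        then obtain f where "f \<in> L1_01" "b = T f" by blast
        then show "b \<in> P ` ces_inf" using PT T_ces by (metis imageI)
      qed
    qed
    show "T (\<lambda>x. f x + g x) = (\<lambda>n. T f n + T g n)" if "f \<in> L1_01" "g \<in> L1_01" for f g
      using T_lin[OF that, of 1 1] by simp
    show "T (\<lambda>x. r * f x) = (\<lambda>n. r * T f n)" if "f \<in> L1_01" for f r
      using T_lin[OF that that, of r 0] by simp
    show "P (\<lambda>n. a n + b n) = (\<lambda>n. P a n + P b n)" if "a \<in> ces_inf" "b \<in> ces_inf" for a b
      using P_lin[OF that, of 1 1] by simp
    show "P (\<lambda>n. r * a n) = (\<lambda>n. r * P a n)" if "a \<in> ces_inf" for a r
      using P_lin[OF that that, of r 0] by simp
    show "P (P a) = P a" if "a \<in> ces_inf" for a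
      using PT[OF dens[OF that]] by (simp add: P_def)
  qed (use T_ces T_le T_ge P_norm dens in \<open>auto simp: P_def\<close>)
qed

end
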